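(* Consider a Quotient Hash Table (QHT) with $N$ rows, $k$ cells (buckets) per row and $S$ possible fingerprints, with $1\le k\le S$, processing a stream of elements drawn from an alphabet $\Gamma$ of size $U$, under the probabilistic model described in the context. Let $\operatorname{FN}_m$ be the probability that the $(m+1)$-th element of the stream, if it is a duplicate, is a false negative, let $\operatorname{FNR}_n=\frac1n\sum_{m=1}^n\operatorname{FN}_m$, and let $\operatorname{FNR}_\infty=\lim_{n\to\infty}\operatorname{FNR}_n$. Then, assuming $U\gg N$ (i.e. in the limit $U\to\infty$ with $N,k,S$ fixed), $\operatorname{FNR}_\infty = 1-\frac{k}{S}$.
   Context: Let $\Gamma$ be a finite set with $U=|\Gamma|$, and let $E=(e_1,e_2,\dots)$ be a stream of elements of $\Gamma$. An element $e_i$ is a duplicate if $e_j=e_i$ for some $j<i$, and unseen otherwise. A QHT has a state $T$ which is an $N\times k$ array whose cells are either empty or contain a fingerprint in $\{0,\dots,S-1\}$; initially all cells are empty. It uses a hash function $h:\Gamma\to\{0,\dots,N-1\}$ (the row) and a fingerprint function $s:\Gamma\to\{0,\dots,S-1\}$. Processing an element $e$: if some cell of row $T[h(e)]$ contains $s(e)$, output DUPLICATE and leave the state unchanged; otherwise store $s(e)$ in the first empty cell of row $T[h(e)]$, or, if the row has no empty cell, in a cell of that row chosen uniformly at random (overwriting its content), and output UNSEEN. A false negative is a duplicate element for which the output is UNSEEN. Model assumptions: $h$ and $s$ are modelled as independent uniformly random functions (so that for each element the pair $(h(e),s(e))$ is uniform over the $NS$ possibilities), the stream elements are sampled independently and uniformly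 from $\Gamma$, and every cell of the table is assumed to be non-empty. *)

theory Defs
  imports "HOL-Probability.Probability"
begin

text \<open>A table maps a row and a cell index to the content of that cell, \<open>None\<close> being an empty
  cell. Only rows below \<open>N\<close> and cells below \<open>k\<close> are ever read or written.\<close>

type_synonym table = "nat \<Rightarrow> nat \<Rightarrow> nat option"

datatype answer = DUPLICATE | UNSEEN

definition empty_table :: table where
  "empty_table = (\<lambda>r c. None)"

definition full_table :: "nat \<Rightarrow> nat \<Rightarrow> table \<Rightarrow> bool" where
  "full_table N k T \<longleftrightarrow> (\<forall>r<N. \<forall>c<k. T r c \<noteq> None)"

definition store :: "table \<Rightarrow> nat \<Rightarrow> nat \<Rightarrow> nat \<Rightarrow> table" where
  "store T r c f = T(r := (T r)(c := Some f))"

definition qht_step ::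
  "nat \<Rightarrow> ('a \<Rightarrow> nat) \<Rightarrow> ('a \<Rightarrow> nat) \<Rightarrow> table \<Rightarrow> 'a \<Rightarrow> (answer \<times> table) pmf" where
  "qht_step k h s T e =
     (if \<exists>c<k. T (h e) c = Some (s e) then return_pmf (DUPLICATE, T)
      else if \<exists>c<k. T (h e) c = None
        then return_pmf (UNSEEN, store T (h e) (LEAST c. c < k \<and> T (h e) c = None) (s e))
      else map_pmf (\<lambda>c. (UNSEEN, store T (h e) c (s e))) (pmf_of_set {..<k}))"

fun qht_run ::
  "nat \<Rightarrow> ('a \<Rightarrow> nat) \<Rightarrow> ('a \<Rightarrow> nat) \<Rightarrow> table \<Rightarrow> 'a list \<Rightarrow> table pmf" where
  "qht_run k h s T [] = return_pmf T"
| "qht_run k h s T (e # es) =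
     bind_pmf (qht_step k h s T e) (\<lambda>(_, T'). qht_run k h s T' es)"

text \<open>Joint law of the first \<open>m\<close> stream elements, the table after processing them, the
  \<open>(m+1)\<close>-th element and the output on it. The hash and fingerprint functions are drawn once,
  before the stream.\<close>

definition qht_experiment ::
  "nat \<Rightarrow> nat \<Rightarrow> nat \<Rightarrow> 'a set \<Rightarrow> nat \<Rightarrow> ('a list \<times> table \<times> 'a \<times> answer) pmf" where
  "qht_experiment N k S \<Gamma> m =
     do {
       h \<leftarrow> pmf_of_set (\<Gamma> \<rightarrow>\<^sub>E {..<N});
       s \<leftarrow> pmf_of_set (\<Gamma> \<rightarrow>\<^sub>E {..<S});
       es \<leftarrow> replicate_pmf m (pmf_of_set \<Gamma>);
       T \<leftarrow> qht_run k h s empty_table es;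
       e \<leftarrow> pmf_of_set \<Gamma>;
       (out, T') \<leftarrow> qht_step k h s T e;
       return_pmf (es, T, e, out)
     }"

text \<open>The table starts empty, so the modelling assumption that no cell is empty is read as
  conditioning on the table being full when the \<open>(m+1)\<close>-th element arrives. When the conditioning
  event is null (in particular for \<open>m < N * k\<close>) the value is \<open>0\<close>; if \<open>card \<Gamma> \<ge> N * k\<close> and \<open>k \<le> S\<close>,
  this concerns finitely many \<open>m\<close> only.\<close>

definition FN :: "nat \<Rightarrow> nat \<Rightarrow> nat \<Rightarrow> 'a set \<Rightarrow> nat \<Rightarrow> real" where
  "FN N k S \<Gamma> m =
     cond_prob (measure_pmf (qht_experiment N k S \<Gamma> m))
       (\<lambda>(es, T, e, out). out = UNSEEN)
       (\<lambda>(es, T, e, out). e \<in> set es \<and> full_table N k T)"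

definition FNR :: "nat \<Rightarrow> nat \<Rightarrow> nat \<Rightarrow> 'a set \<Rightarrow> nat \<Rightarrow> real" where
  "FNR N k S \<Gamma> n = (1 / real n) * (\<Sum>m=1..n. FN N k S \<Gamma> m)"

definition FNR_inf :: "nat \<Rightarrow> nat \<Rightarrow> nat \<Rightarrow> 'a set \<Rightarrow> real" where
  "FNR_inf N k S \<Gamma> = lim (\<lambda>n. FNR N k S \<Gamma> n)"

end

theory Submission
  imports Defs
begin

text \<open>Fix the hash and fingerprint functions. The table is then a Markov chain on a finite state
  space, so the mean ergodic theorem makes the averages of the probability of answering UNSEEN on
  a full table converge. The probability of a full table increases to a limit \<open>p\<close>, and after \<open>m\<close>
  elements the next one is not a duplicate with probability \<open>(1 - 1/U)\<^sup>m\<close>, which tends to \<open>0\<close>; hence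
  the conditional probabilities average to a limit (and are all \<open>0\<close> if \<open>p = 0\<close>).

  For the value of the limit no stationary distribution is needed. By Hoeffding's inequality, with
  probability tending to \<open>1\<close> as \<open>U\<close> grows, every (row, fingerprint) pair is attained by a fraction
  of \<open>\<Gamma>\<close> within \<open>\<epsilon>\<close> of \<open>1 / (N * S)\<close>. In that case the table fills up almost surely, and since the
  \<open>k\<close> fingerprints in a row are always distinct, \<^emph>\<open>every\<close> full table answers UNSEEN to a fraction of
  \<open>\<Gamma>\<close> within \<open>N * k * \<epsilon>\<close> of \<open>1 - k / S\<close>.\<close>

section \<open>Expectations\<close>

lemma expectation_bind_pmf_bounded:
  fixes f :: "'b \<Rightarrow> real"
  assumes "\<And>y. \<bar>f y\<bar> \<le> B"
  shows "measure_pmf.expectation (bind_pmf p g) f =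
    measure_pmf.expectation p (\<lambda>x. measure_pmf.expectation (g x) f)"
  unfolding measure_pmf_bind
  by (rule integral_bind[where K = "count_space UNIV" and B = B and B' = 1])
     (use assms in \<open>auto simp: measure_pmf.emeasure_space_1 measure_pmf_in_subprob_algebra measure_pmf.finite_measure\<close>)

lemma integrable_measure_pmf_bounded:
  fixes f :: "'b \<Rightarrow> real"
  assumes "\<And>y. y \<in> set_pmf p \<Longrightarrow> \<bar>f y\<bar> \<le> B"
  shows "integrable (measure_pmf p) f"
  by (rule measure_pmf.integrable_const_bound[where B = B]) (use assms in \<open>auto simp: AE_measure_pmf_iff\<close>)

lemma abs_expectation_le:
  fixes f :: "'b \<Rightarrow> real"
  assumes "\<And>y. y \<in> set_pmf p \<Longrightarrow> \<bar>f y\<bar> \<le> B"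
  shows "\<bar>measure_pmf.expectation p f\<bar> \<le> B"
proof -
  have i: "integrable (measure_pmf p) f" by (rule integrable_measure_pmf_bounded) fact
  have "\<bar>measure_pmf.expectation p f\<bar> \<le> measure_pmf.expectation p (\<lambda>x. \<bar>f x\<bar>)"
    by (rule integral_abs_bound)
  also have "\<dots> \<le> measure_pmf.expectation p (\<lambda>x. B)"
    by (rule integral_mono_AE) (use assms i in \<open>auto simp: AE_measure_pmf_iff\<close>)
  finally show ?thesis by simp
qed

lemma expectation_mono_pmf:
  fixes f g :: "'b \<Rightarrow> real"
  assumes "\<And>y. y \<in> set_pmf p \<Longrightarrow> \<bar>f y\<bar> \<le> B" "\<And>y. y \<in> set_pmf p \<Longrightarrow> \<bar>g y\<bar> \<le> C"
    "\<And>y. y \<in> set_pmf p \<Longrightarrow> f y \<le> g y"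
  shows "measure_pmf.expectation p f \<le> measure_pmf.expectation p g"
  by (rule integral_mono_AE)
     (use assms in \<open>auto simp: AE_measure_pmf_iff intro: integrable_measure_pmf_bounded\<close>)

lemma expectation_cong_pmf:
  fixes f g :: "'b \<Rightarrow> real"
  assumes "\<And>y. y \<in> set_pmf p \<Longrightarrow> f y = g y"
  shows "measure_pmf.expectation p f = measure_pmf.expectation p g"
  by (rule integral_cong_AE) (use assms in \<open>auto simp: AE_measure_pmf_iff\<close>)

section \<open>Arithmetic means of sequences\<close>

text \<open>Summation starts at index 1 as in \<open>FNR\<close>, so that \<open>FNR\<close> is
  \<open>mean\<close> applied to \<open>FN\<close> by unfolding. The mean of length 0 is 0.\<close>

definition mean :: "(nat \<Rightarrow> real) \<Rightarrow> nat \<Rightarrow> real" where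
  "mean v n = (1 / real n) * (\<Sum>m=1..n. v m)"

lemma mean_diff: "mean (\<lambda>m. v m - w m) n = mean v n - mean w n"
  by (simp add: mean_def sum_subtractf algebra_simps)

lemma mean_cmult: "mean (\<lambda>m. c * v m) n = c * mean v n"
  by (simp add: mean_def sum_distrib_left algebra_simps)

lemma mean_sum: "mean (\<lambda>m. \<Sum>i\<in>I. v i m) n = (\<Sum>i\<in>I. mean (v i) n)"
  unfolding mean_def by (subst sum.swap) (simp add: sum_distrib_left)

lemma abs_mean_le:
  assumes "\<And>m. m \<in> {1..n} \<Longrightarrow> \<bar>v m\<bar> \<le> B" "0 \<le> B"
  shows "\<bar>mean v n\<bar> \<le> B"
proof (cases "n = 0")
  case True
  then show ?thesis using assms(2) by (simp add: mean_def)
next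
  case False
  have "\<bar>\<Sum>m=1..n. v m\<bar> \<le> (\<Sum>m=1..n. \<bar>v m\<bar>)" by (rule sum_abs)
  also have "\<dots> \<le> real n * B" using sum_bounded_above[of "{1..n}" "\<lambda>m. \<bar>v m\<bar>" B] assms(1) by simp
  finally show ?thesis using False by (simp add: mean_def abs_mult field_simps)
qed

text \<open>Cesaro's argument: the terms up to \<open>M\<close> contribute a fixed amount
  \<open>C\<close>, which division by \<open>n\<close> makes small, and every later term is below
  \<open>e / 2\<close>.\<close>

lemma mean_tendsto_zero:
  assumes "v \<longlonglongrightarrow> 0"
  shows "mean v \<longlonglongrightarrow> 0"
proof (rule LIMSEQ_I)
  fix e :: real assume "e > 0"
  then obtain M where M: "\<And>m. m \<ge> M \<Longrightarrow> \<bar>v m\<bar> < e / 2"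
    using LIMSEQ_D[OF assms, of "e / 2"] by auto
  define C where "C = (\<Sum>m=1..M. \<bar>v m\<bar>)"
  have "C \<ge> 0" by (simp add: C_def sum_nonneg)
  obtain n0 :: nat where n0: "real n0 > 2 * C / e" using reals_Archimedean2 by blast
  show "\<exists>no. \<forall>n\<ge>no. norm (mean v n - 0) < e"
  proof (intro exI allI impI)
    fix n assume n: "n \<ge> max (Suc M) n0"
    have "{1..n} = {1..M} \<union> {M<..n}" "{1..M} \<inter> {M<..n} = {}" using n by auto
    then have "(\<Sum>m=1..n. \<bar>v m\<bar>) = C + (\<Sum>m\<in>{M<..n}. \<bar>v m\<bar>)"
      by (simp add: sum.union_disjoint C_def)
    also have "(\<Sum>m\<in>{M<..n}. \<bar>v m\<bar>) \<le> real (n - M) * (e / 2)"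
      using sum_bounded_above[of "{M<..n}" "\<lambda>m. \<bar>v m\<bar>" "e / 2"] M by (simp add: less_imp_le)
    also have "\<dots> \<le> real n * (e / 2)" using \<open>e > 0\<close> by (intro mult_right_mono) auto
    also have "C < real n * (e / 2)"
    proof -
      have "2 * C / e < real n" using n0 n by linarith
      then show ?thesis using \<open>e > 0\<close> by (simp add: field_simps)
    qed
    finally have "(\<Sum>m=1..n. \<bar>v m\<bar>) < real n * e" by (simp add: mult.commute)
    then have "\<bar>\<Sum>m=1..n. v m\<bar> < real n * e"
      using sum_abs[of v "{1..n}"] by linarith
    then show "norm (mean v n - 0) < e" using n by (simp add: mean_def abs_mult field_simps)
  qed
qed

lemma mean_tendsto:
  assumes "v \<longlonglongrightarrow> l"
  shows "mean v \<longlonglongrightarrow> l"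
proof -
  have "mean (\<lambda>m. v m - l) \<longlonglongrightarrow> 0"
    by (rule mean_tendsto_zero) (use assms in \<open>simp add: LIM_zero\<close>)
  moreover have "eventually (\<lambda>n. mean (\<lambda>m. v m - l) n = mean v n - l) sequentially"
    using eventually_gt_at_top[of 0] by eventually_elim (simp add: mean_diff, simp add: mean_def)
  ultimately have "(\<lambda>n. mean v n - l) \<longlonglongrightarrow> 0" by (simp add: tendsto_cong)
  then show ?thesis by (simp add: LIM_zero_iff)
qed

text \<open>Moving the window by one place exchanges one term for another and so changes the sum by
  at most \<open>2 * B\<close>; a shift by \<open>i\<close> is \<open>i\<close> such moves.\<close>

lemma abs_mean_shift_le:
  assumes "\<And>m. \<bar>v m\<bar> \<le> B"
  shows "\<bar>mean (\<lambda>m. v (m + i)) n - mean v n\<bar> \<le> 2 * real i * B / real n"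
proof -
  have "\<bar>(\<Sum>m=1..n. v (m + i)) - (\<Sum>m=1..n. v m)\<bar> \<le> 2 * real i * B"
  proof (induction i)
    case (Suc i)
    have "(\<Sum>m=1..n. v (m + Suc i)) - (\<Sum>m=1..n. v (m + i)) = v (Suc n + i) - v (Suc i)"
      by (induction n) auto
    then have "\<bar>(\<Sum>m=1..n. v (m + Suc i)) - (\<Sum>m=1..n. v (m + i))\<bar> \<le> 2 * B"
      using assms[of "Suc n + i"] assms[of "Suc i"] by linarith
    with Suc show ?case by (simp add: algebra_simps)
  qed simp
  moreover have "mean (\<lambda>m. v (m + i)) n - mean v n
      = ((\<Sum>m=1..n. v (m + i)) - (\<Sum>m=1..n. v m)) / real n"
    by (simp add: mean_def diff_divide_distrib)
  ultimately show ?thesis by (simp add: abs_divide divide_right_mono)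
qed

section \<open>The mean ergodic theorem for finite Markov chains\<close>

text \<open>The first step is split off, not the last, in parallel with \<open>qht_run\<close>,
  which consumes its list from the head.\<close>

primrec markov_iterate :: "('x \<Rightarrow> 'x pmf) \<Rightarrow> nat \<Rightarrow> 'x \<Rightarrow> 'x pmf" where
  "markov_iterate K 0 x = return_pmf x"
| "markov_iterate K (Suc m) x = bind_pmf (K x) (markov_iterate K m)"

lemma markov_iterate_add:
  "markov_iterate K (m + i) x = bind_pmf (markov_iterate K m x) (markov_iterate K i)"
  by (induction m arbitrary: x) (auto simp: bind_return_pmf bind_assoc_pmf intro: bind_pmf_cong)

lemma set_markov_iterate_subset:
  assumes "\<And>x. x \<in> X \<Longrightarrow> set_pmf (K x) \<subseteq> X" "x \<in> X"
  shows "set_pmf (markov_iterate K m x) \<subseteq> X"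
  using assms(2) by (induction m arbitrary: x) (use assms(1) in \<open>fastforce+\<close>)

text \<open>Bolzano-Weierstrass at one point after another: each new point refines the subsequence
  found so far, which preserves convergence at the earlier points.\<close>

lemma finite_pointwise_convergent_subsequence:
  fixes f :: "nat \<Rightarrow> 'x \<Rightarrow> real"
  assumes "finite X" "\<And>n x. \<bar>f n x\<bar> \<le> B"
  shows "\<exists>r. strict_mono r \<and> (\<forall>x\<in>X. convergent (\<lambda>j. f (r j) x))"
  using assms(1)
proof (induction X)
  case empty
  then show ?case by (intro exI[of _ id]) (simp add: strict_mono_def)
next
  case (insert x X)
  then obtain r where r: "strict_mono r" "\<forall>y\<in>X. convergent (\<lambda>j. f (r j) y)" by blast
  have "bounded (range (\<lambda>j. f (r j) x))"
    by (rule boundedI[of _ B]) (use assms(2) in auto)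
  then obtain l q where q: "strict_mono q" "((\<lambda>j. f (r j) x) \<circ> q) \<longlonglongrightarrow> l"
    using bounded_imp_convergent_subsequence by blast
  have "convergent (\<lambda>j. f ((r \<circ> q) j) y)" if "y \<in> insert x X" for y
  proof (cases "y = x")
    case True
    then show ?thesis using q(2) by (auto simp: convergent_def o_def)
  next
    case False
    then show ?thesis using convergent_subseq_convergent[OF _ q(1)] r(2) that
      by (fastforce simp: o_def)
  qed
  then show ?case using strict_mono_o[OF r(1) q(1)] by blast
qed

text \<open>A subsequential limit \<open>y\<close> of the means is invariant under the kernel. If the mean of length \<open>p\<close>
  is close to \<open>y\<close>, then averaging it along the chain stays close to \<open>y\<close>, and for \<open>n \<rightarrow> \<infinity>\<close> this
  double average differs from the mean of length \<open>n\<close> by \<open>O(p / n)\<close> only.\<close>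

theorem markov_mean_ergodic:
  fixes g :: "'x \<Rightarrow> real"
  assumes X: "finite X" "\<And>x. x \<in> X \<Longrightarrow> set_pmf (K x) \<subseteq> X" and x0: "x0 \<in> X"
    and g: "\<And>x. \<bar>g x\<bar> \<le> B"
  shows "convergent (mean (\<lambda>m. measure_pmf.expectation (markov_iterate K m x0) g))"
proof -
  define u where "u = (\<lambda>m x. measure_pmf.expectation (markov_iterate K m x) g)"
  define A where "A = (\<lambda>n x. mean (\<lambda>m. u m x) n)"
  have "B \<ge> 0" using g[of x0] by linarith
  have ub: "\<bar>u m x\<bar> \<le> B" for m x
    unfolding u_def by (rule abs_expectation_le) (rule g)
  have Ab: "\<bar>A n x\<bar> \<le> B" for n x unfolding A_def by (rule abs_mean_le[OF ub \<open>B \<ge> 0\<close>])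
  have uadd: "measure_pmf.expectation (markov_iterate K m x) (u i) = u (m + i) x" for m i x
    unfolding u_def markov_iterate_add by (rule expectation_bind_pmf_bounded[symmetric]) (rule g)
  have Aadd: "measure_pmf.expectation (markov_iterate K m x) (A n) = mean (\<lambda>i. u (m + i) x) n" for m n x
  proof -
    have "measure_pmf.expectation (markov_iterate K m x) (A n) =
        (1 / real n) * (\<Sum>i=1..n. measure_pmf.expectation (markov_iterate K m x) (u i))"
      unfolding A_def mean_def
      by (subst integral_mult_right_zero, subst Bochner_Integration.integral_sum)
         (auto intro: integrable_measure_pmf_bounded[of _ _ B] ub)
    then show ?thesis by (simp add: uadd mean_def)
  qed
  obtain r where r: "strict_mono r" "\<forall>x\<in>X. convergent (\<lambda>j. A (r j) x)"
    using finite_pointwise_convergent_subsequence[OF X(1), of A B] Ab by blast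
  define y where "y = (\<lambda>x. lim (\<lambda>j. A (r j) x))"
  have y: "(\<lambda>j. A (r j) x) \<longlonglongrightarrow> y x" if "x \<in> X" for x
    using r(2) that unfolding y_def by (simp add: convergent_LIMSEQ_iff)
  have finite_sum: "measure_pmf.expectation (markov_iterate K m x) f =
      (\<Sum>z\<in>X. f z * pmf (markov_iterate K m x) z)" if "x \<in> X" for m x and f :: "'x \<Rightarrow> real"
    by (rule integral_measure_pmf_real[OF X(1)])
       (use set_markov_iterate_subset[of X K, OF X(2) that] in blast)
  have r_top: "filterlim r at_top sequentially" by (rule filterlim_subseq) fact
  \<comment> \<open>Running the chain for \<open>m\<close> steps before averaging only shifts the
    window by \<open>m\<close>, which is invisible in the limit. Since \<open>X\<close> is finite,
    the limit passes through the expectation.\<close>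
  have inv: "measure_pmf.expectation (markov_iterate K m x) y = y x" if "x \<in> X" for m x
  proof (rule LIMSEQ_unique)
    show "(\<lambda>j. measure_pmf.expectation (markov_iterate K m x) (A (r j)))
        \<longlonglongrightarrow> measure_pmf.expectation (markov_iterate K m x) y"
      unfolding finite_sum[OF that] by (intro tendsto_sum tendsto_mult_right y)
    have "(\<lambda>n. mean (\<lambda>i. u (i + m) x) n - mean (\<lambda>i. u i x) n) \<longlonglongrightarrow> 0"
    proof (rule Lim_null_comparison)
      show "\<forall>\<^sub>F n in sequentially. norm (mean (\<lambda>i. u (i + m) x) n - mean (\<lambda>i. u i x) n)
          \<le> 2 * real m * B / real n"
        unfolding real_norm_def by (intro always_eventually allI abs_mean_shift_le ub)
      show "(\<lambda>n. 2 * real m * B / real n) \<longlonglongrightarrow> 0" by (rule lim_const_over_n)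
    qed
    from tendsto_add[OF filterlim_compose[OF this r_top] y[OF that]]
    show "(\<lambda>j. measure_pmf.expectation (markov_iterate K m x) (A (r j))) \<longlonglongrightarrow> y x"
      unfolding Aadd by (simp add: A_def add.commute)
  qed
  have "(\<lambda>n. A n x0) \<longlonglongrightarrow> y x0"
  proof (rule LIMSEQ_I)
    fix e :: real assume e: "e > 0"
    have "eventually (\<lambda>j. \<forall>x\<in>X. dist (A (r j) x) (y x) < e / 2) sequentially"
      using X(1) y e by (intro eventually_ball_finite ballI tendstoD) auto
    moreover have "eventually (\<lambda>j. r j > 0) sequentially"
      using r_top eventually_gt_at_top filterlim_iff by blast
    ultimately obtain j where j: "\<forall>x\<in>X. dist (A (r j) x) (y x) < e / 2" "r j > 0"
      using eventually_happens[OF eventually_conj] by force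
    define p where "p = r j"
    \<comment> \<open>By invariance of \<open>y\<close>, the difference is the expected value of
      \<open>A p - y\<close> after \<open>m\<close> steps; the chain stays in \<open>X\<close>,
      where this function is below \<open>e / 2\<close> in absolute value.\<close>
    have near: "\<bar>mean (\<lambda>i. u (m + i) x0) p - y x0\<bar> \<le> e / 2" for m
    proof -
      have "mean (\<lambda>i. u (m + i) x0) p - y x0 =
          measure_pmf.expectation (markov_iterate K m x0) (\<lambda>x. A p x - y x)"
        unfolding Aadd[symmetric] inv[OF x0, of m, symmetric] finite_sum[OF x0]
        by (simp add: sum_subtractf left_diff_distrib)
      also have "\<bar>\<dots>\<bar> \<le> e / 2"
        using set_markov_iterate_subset[of X K, OF X(2) x0] j(1)
        by (intro abs_expectation_le) (fastforce simp: dist_real_def p_def)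
      finally show ?thesis .
    qed
    obtain n0 :: nat where n0: "real n0 > 2 * (2 * real p * B) / e" using reals_Archimedean2 by blast
    show "\<exists>no. \<forall>n\<ge>no. norm (A n x0 - y x0) < e"
    proof (intro exI allI impI)
      fix n assume n: "n \<ge> max 1 n0"
      \<comment> \<open>The double average read in the other order: for each \<open>i\<close> it is
        a shifted mean of length \<open>n\<close>, hence close to \<open>A n x0\<close>.\<close>
      have swap: "mean (\<lambda>m. mean (\<lambda>i. u (m + i) x0) p) n = mean (\<lambda>i. mean (\<lambda>m. u (m + i) x0) n) p"
        unfolding mean_def sum_distrib_left by (subst sum.swap) (simp add: mult.commute)
      have c: "mean (\<lambda>m. c) q = c" if "q > 0" for c q using that by (simp add: mean_def)
      have "\<bar>mean (\<lambda>i. mean (\<lambda>m. u (m + i) x0) n - A n x0) p\<bar> \<le> 2 * real p * B / real n"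
      proof (rule abs_mean_le)
        fix i assume "i \<in> {1..p}"
        then have "2 * real i * B / real n \<le> 2 * real p * B / real n"
          using \<open>B \<ge> 0\<close> by (intro divide_right_mono mult_right_mono) auto
        with abs_mean_shift_le[of "\<lambda>m. u m x0" B i n, OF ub]
        show "\<bar>mean (\<lambda>m. u (m + i) x0) n - A n x0\<bar> \<le> 2 * real p * B / real n"
          unfolding A_def by linarith
      qed (use \<open>B \<ge> 0\<close> in simp)
      moreover have "\<bar>mean (\<lambda>m. mean (\<lambda>i. u (m + i) x0) p - y x0) n\<bar> \<le> e / 2"
        by (rule abs_mean_le[OF near]) (use e in simp)
      moreover have "mean (\<lambda>i. mean (\<lambda>m. u (m + i) x0) n - A n x0) p =
          mean (\<lambda>m. mean (\<lambda>i. u (m + i) x0) p - y x0) n - (A n x0 - y x0)"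
        using n j(2) by (simp add: mean_diff swap[unfolded p_def] c p_def)
      moreover have "2 * real p * B / real n < e / 2"
      proof -
        have "2 * (2 * real p * B) / e < real n" using n0 n by linarith
        then show ?thesis using e n by (simp add: field_simps)
      qed
      ultimately show "norm (A n x0 - y x0) < e" unfolding real_norm_def by linarith
    qed
  qed
  then show ?thesis unfolding A_def u_def convergent_def by blast
qed

text \<open>The sequence \<open>a\<close> converges only in mean. But \<open>c\<close> converges to
  \<open>p\<close>, so \<open>b m / c m\<close> differs from \<open>a m / p\<close> by a null
  sequence, and null sequences have null means. It is applied with \<open>b\<close> and
  \<open>c\<close> the numerator and denominator of \<open>FN\<close>, and with \<open>a\<close> and
  \<open>d\<close> the same probabilities without the duplicate condition.\<close>

lemma mean_quotient_tendsto:
  fixes a b c d \<delta> :: "nat \<Rightarrow> real"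
  assumes ba: "\<And>m. \<bar>b m - a m\<bar> \<le> \<delta> m" and cd: "\<And>m. \<bar>c m - d m\<bar> \<le> \<delta> m"
    and \<delta>: "\<delta> \<longlonglongrightarrow> 0" and d: "d \<longlonglongrightarrow> p" and p: "p > 0"
    and a: "\<And>m. \<bar>a m\<bar> \<le> B" "mean a \<longlonglongrightarrow> \<alpha>"
  shows "mean (\<lambda>m. b m / c m) \<longlonglongrightarrow> \<alpha> / p"
proof -
  have "(\<lambda>m. c m - d m) \<longlonglongrightarrow> 0"
    by (rule Lim_null_comparison[OF _ \<delta>]) (simp add: cd)
  from tendsto_add[OF this d] have c: "c \<longlonglongrightarrow> p" by simp
  have ba0: "(\<lambda>m. b m - a m) \<longlonglongrightarrow> 0"
    by (rule Lim_null_comparison[OF _ \<delta>]) (simp add: ba)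
  have "(\<lambda>m. 1 / c m) \<longlonglongrightarrow> 1 / p"
    using p by (intro tendsto_divide tendsto_const c) simp
  then have "(\<lambda>m. B * \<bar>1 / c m - 1 / p\<bar>) \<longlonglongrightarrow> 0"
    by (intro tendsto_mult_right_zero tendsto_rabs_zero) (simp add: LIM_zero)
  then have "(\<lambda>m. a m * (1 / c m - 1 / p)) \<longlonglongrightarrow> 0"
    by (rule Lim_null_comparison[rotated]) (simp only: real_norm_def abs_mult,
      intro always_eventually allI mult_right_mono a(1) abs_ge_zero)
  moreover have "(\<lambda>m. (b m - a m) / c m) \<longlonglongrightarrow> 0"
    using tendsto_divide[OF ba0 c] p by simp
  ultimately have "(\<lambda>m. (b m - a m) / c m + a m * (1 / c m - 1 / p)) \<longlonglongrightarrow> 0"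
    using tendsto_add by fastforce
  then have "(\<lambda>m. b m / c m - (1 / p) * a m) \<longlonglongrightarrow> 0"
    by (simp add: algebra_simps diff_divide_distrib)
  then have "mean (\<lambda>m. b m / c m - (1 / p) * a m) \<longlonglongrightarrow> 0" by (rule mean_tendsto_zero)
  moreover have "(\<lambda>n. (1 / p) * mean a n) \<longlonglongrightarrow> (1 / p) * \<alpha>" by (intro tendsto_mult_left a(2))
  ultimately have "(\<lambda>n. mean (\<lambda>m. b m / c m - (1 / p) * a m) n + (1 / p) * mean a n) \<longlonglongrightarrow> 0 + (1 / p) * \<alpha>"
    by (rule tendsto_add)
  then show ?thesis by (simp only: mean_diff mean_cmult) simp
qed

section \<open>The table as a Markov chain\<close>

text \<open>Forcing the cells outside the array to be empty leaves finitely many valid tables in an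
  infinite type, as the ergodic theorem requires. Distinctness within a row makes a full table
  recognise exactly \<open>N * k\<close> pairs of row and fingerprint.\<close>

definition valid_table :: "nat \<Rightarrow> nat \<Rightarrow> nat \<Rightarrow> table \<Rightarrow> bool" where
  "valid_table N k S T \<longleftrightarrow> (\<forall>r c f. T r c = Some f \<longrightarrow> r < N \<and> c < k \<and> f < S) \<and>
    (\<forall>r c c' f. T r c = Some f \<longrightarrow> T r c' = Some f \<longrightarrow> c = c')"

definition empty_cells :: "nat \<Rightarrow> nat \<Rightarrow> table \<Rightarrow> (nat \<times> nat) set" where
  "empty_cells N k T = {(r, c). r < N \<and> c < k \<and> T r c = None}"

definition seen :: "nat \<Rightarrow> ('a \<Rightarrow> nat) \<Rightarrow> ('a \<Rightarrow> nat) \<Rightarrow> table \<Rightarrow> 'a \<Rightarrow> bool" where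
  "seen k h s T e \<longleftrightarrow> (\<exists>c<k. T (h e) c = Some (s e))"

definition qht_kernel ::
  "nat \<Rightarrow> ('a \<Rightarrow> nat) \<Rightarrow> ('a \<Rightarrow> nat) \<Rightarrow> 'a pmf \<Rightarrow> table \<Rightarrow> table pmf" where
  "qht_kernel k h s p T = bind_pmf p (\<lambda>e. map_pmf snd (qht_step k h s T e))"

lemma finite_valid_tables: "finite {T. valid_table N k S T}"
proof -
  define R where "R = {g. \<forall>c. (c \<in> {..<k} \<longrightarrow> g c \<in> insert None (Some ` {..<S})) \<and> (c \<notin> {..<k} \<longrightarrow> g c = None)}"
  have "finite R" unfolding R_def by (rule finite_set_of_finite_funs) auto
  then have fin: "finite {T. \<forall>r. (r \<in> {..<N} \<longrightarrow> T r \<in> R) \<and> (r \<notin> {..<N} \<longrightarrow> T r = (\<lambda>c. None))}"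
    by (intro finite_set_of_finite_funs) auto
  moreover have "T r \<in> R" if "valid_table N k S T" for T r
  proof -
    have "T r c \<in> insert None (Some ` {..<S})" "c \<ge> k \<Longrightarrow> T r c = None" for c
      using that unfolding valid_table_def by (cases "T r c"; force)+
    then show ?thesis unfolding R_def by auto
  qed
  moreover have "T r = (\<lambda>c. None)" if "valid_table N k S T" "r \<ge> N" for T r
  proof
    fix c show "T r c = None"
      using that unfolding valid_table_def by (cases "T r c") force+
  qed
  ultimately show ?thesis by (intro finite_subset[OF _ fin]) auto
qed

lemma finite_empty_cells: "finite (empty_cells N k T)"
  by (rule finite_subset[of _ "{..<N} \<times> {..<k}"]) (auto simp: empty_cells_def)

lemma card_empty_cells_le: "card (empty_cells N k T) \<le> N * k"
  using card_mono[of "{..<N} \<times> {..<k}" "empty_cells N k T"] by (auto simp: empty_cells_def)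

lemma full_table_iff: "full_table N k T \<longleftrightarrow> empty_cells N k T = {}"
  by (auto simp: full_table_def empty_cells_def)

text \<open>Unites storing in the first empty cell and random overwriting. The final implication
  retains the one difference that matters for counting empty cells: a free cell is
  preferred.\<close>

lemma set_qht_step:
  assumes "k \<ge> 1" "(out, T') \<in> set_pmf (qht_step k h s T e)"
  shows "(seen k h s T e \<and> out = DUPLICATE \<and> T' = T) \<or>
    (\<not> seen k h s T e \<and> out = UNSEEN \<and> (\<exists>c<k. T' = store T (h e) c (s e) \<and>
      ((\<exists>c'<k. T (h e) c' = None) \<longrightarrow> T (h e) c = None)))"
proof (cases "\<exists>c<k. T (h e) c = None")
  case True
  then have "(LEAST c. c < k \<and> T (h e) c = None) < k \<and> T (h e) (LEAST c. c < k \<and> T (h e) c = None) = None"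
    by (rule LeastI_ex)
  then show ?thesis using assms True unfolding qht_step_def seen_def
    by (auto split: if_splits)
next
  case False
  have "set_pmf (pmf_of_set {..<k}) = {..<k}" using assms(1) by (intro set_pmf_of_set) (auto simp: lessThan_empty_iff)
  then have "\<exists>c<k. T' = store T (h e) c (s e)" "out = UNSEEN" if "\<not> seen k h s T e"
    using assms(2) False that unfolding qht_step_def seen_def by auto
  moreover have "T' = T" "out = DUPLICATE" if "seen k h s T e"
    using assms(2) that unfolding qht_step_def seen_def by auto
  ultimately show ?thesis using False by blast
qed

text \<open>A fingerprint is written only if its row does not contain it already, so no step creates
  a repetition.\<close>

lemma valid_table_step:
  assumes "k \<ge> 1" "valid_table N k S T" "h e < N" "s e < S" "(out, T') \<in> set_pmf (qht_step k h s T e)"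
  shows "valid_table N k S T'"
  using set_qht_step[OF assms(1,5)]
proof (elim disjE conjE exE)
  fix c assume n: "\<not> seen k h s T e" and c: "c < k" "T' = store T (h e) c (s e)"
  show ?thesis
    using n assms(2-4) c unfolding valid_table_def seen_def store_def
    by (auto split: if_splits)
qed (use assms in simp)

lemma empty_cells_step:
  assumes "k \<ge> 1" "(out, T') \<in> set_pmf (qht_step k h s T e)"
  shows "empty_cells N k T' \<subseteq> empty_cells N k T"
  using set_qht_step[OF assms] by (auto simp: empty_cells_def store_def split: if_splits)

lemma empty_cells_step_strict:
  assumes "k \<ge> 1" "(out, T') \<in> set_pmf (qht_step k h s T e)"
    and "h e < N" "\<not> seen k h s T e" "\<exists>c<k. T (h e) c = None"
  shows "empty_cells N k T' \<subset> empty_cells N k T"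
proof -
  obtain c where c: "c < k" "T' = store T (h e) c (s e)" "T (h e) c = None"
    using set_qht_step[OF assms(1,2)] assms(4,5) by auto
  then have "(h e, c) \<in> empty_cells N k T" "(h e, c) \<notin> empty_cells N k T'"
    using assms(3) by (auto simp: empty_cells_def store_def)
  then show ?thesis using empty_cells_step[OF assms(1,2)] by blast
qed

text \<open>With \<open>h\<close> and \<open>s\<close> fixed, drawing the whole stream in advance
  and drawing each element on arrival give the same law for the table.\<close>

lemma replicate_qht_run_eq_markov_iterate:
  "bind_pmf (replicate_pmf m p) (qht_run k h s T) = markov_iterate (qht_kernel k h s p) m T"
proof (induction m arbitrary: T)
  case (Suc m)
  have "bind_pmf (replicate_pmf (Suc m) p) (qht_run k h s T) =
     bind_pmf p (\<lambda>e. bind_pmf (replicate_pmf m p)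
       (\<lambda>es. bind_pmf (qht_step k h s T e) (\<lambda>z. qht_run k h s (snd z) es)))"
    by (simp add: bind_assoc_pmf bind_return_pmf case_prod_unfold)
  \<comment> \<open>The draw of the remaining elements is independent of the treatment of the first
    one and may be postponed until after it.\<close>
  also have "\<dots> = bind_pmf p (\<lambda>e. bind_pmf (qht_step k h s T e)
       (\<lambda>z. bind_pmf (replicate_pmf m p) (qht_run k h s (snd z))))"
    by (subst bind_commute_pmf) simp
  also have "\<dots> = markov_iterate (qht_kernel k h s p) (Suc m) T"
    by (simp only: Suc markov_iterate.simps qht_kernel_def[of k h s p T] bind_assoc_pmf bind_map_pmf)
  finally show ?case .
qed (simp add: bind_return_pmf)

lemma expectation_qht_kernel:
  fixes f :: "table \<Rightarrow> real"
  assumes "\<And>T. \<bar>f T\<bar> \<le> B"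
  shows "measure_pmf.expectation (qht_kernel k h s p T) f =
    measure_pmf.expectation p (\<lambda>e. measure_pmf.expectation (qht_step k h s T e) (\<lambda>z. f (snd z)))"
  unfolding qht_kernel_def by (subst expectation_bind_pmf_bounded[of f B]) (use assms in auto)

lemma full_table_step:
  assumes "k \<ge> 1" "(out, T') \<in> set_pmf (qht_step k h s T e)" "full_table N k T"
  shows "full_table N k T'"
  using empty_cells_step[OF assms(1,2)] assms(3) by (auto simp: full_table_iff)

text \<open>Storing never empties a cell, so a full table stays full.\<close>

lemma prob_full_table_mono:
  assumes "k \<ge> 1"
  shows "measure_pmf.expectation (markov_iterate (qht_kernel k h s p) m T) (\<lambda>T. of_bool (full_table N k T) :: real)
    \<le> measure_pmf.expectation (markov_iterate (qht_kernel k h s p) (Suc m) T) (\<lambda>T. of_bool (full_table N k T))"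
proof -
  let ?K = "qht_kernel k h s p" and ?f = "\<lambda>T. of_bool (full_table N k T) :: real"
  have K: "markov_iterate ?K (Suc 0) = ?K" 
    by (rule ext) (simp add: bind_return_pmf' cong: bind_pmf_cong)
  \<comment> \<open>Here the last step is the one to separate, since the comparison is between the
    table after \<open>m\<close> steps and one step later.\<close>
  have "measure_pmf.expectation (markov_iterate ?K (Suc m) T) ?f =
      measure_pmf.expectation (markov_iterate ?K m T) (\<lambda>T'. measure_pmf.expectation (?K T') ?f)"
    using markov_iterate_add[of ?K m "Suc 0" T]
    by (simp add: K del: markov_iterate.simps) (rule expectation_bind_pmf_bounded[where B = 1], simp)
  moreover have "measure_pmf.expectation (markov_iterate ?K m T) ?f \<le> \<dots>"
  proof (rule expectation_mono_pmf[where B = 1 and C = 1])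
    fix T' show "\<bar>measure_pmf.expectation (?K T') ?f\<bar> \<le> 1" by (rule abs_expectation_le) simp
    have "measure_pmf.expectation (?K T') ?f = measure_pmf.expectation (?K T') (\<lambda>_. 1)" if "full_table N k T'"
      by (rule expectation_cong_pmf)
         (use that assms in \<open>auto simp: qht_kernel_def dest!: full_table_step[rotated]\<close>)
    moreover have "0 \<le> measure_pmf.expectation (?K T') ?f" by (rule Bochner_Integration.integral_nonneg) simp
    ultimately show "?f T' \<le> measure_pmf.expectation (?K T') ?f" by (cases "full_table N k T'") simp_all
  qed simp
  ultimately show ?thesis by simp
qed

section \<open>Fixed hash and fingerprint functions\<close>

locale qht =
  fixes N k S :: nat and \<Gamma> :: "'a set"
  assumes N: "1 \<le> N" and k: "1 \<le> k" and kS: "k \<le> S"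
    and \<Gamma>: "finite \<Gamma>" "\<Gamma> \<noteq> {}"

locale qht_hashed = qht N k S \<Gamma> for N k S :: nat and \<Gamma> :: "'a set" +
  fixes h s :: "'a \<Rightarrow> nat"
  assumes h: "\<And>e. e \<in> \<Gamma> \<Longrightarrow> h e < N" and s: "\<And>e. e \<in> \<Gamma> \<Longrightarrow> s e < S"
begin

definition kernel :: "table \<Rightarrow> table pmf" where
  "kernel = qht_kernel k h s (pmf_of_set \<Gamma>)"

definition full_prob :: "nat \<Rightarrow> real" where
  "full_prob m = measure_pmf.expectation (markov_iterate kernel m empty_table) (\<lambda>T. of_bool (full_table N k T))"

text \<open>A joint probability with fullness, not a conditional one, and without the duplicate
  condition: in this form it is the expectation of a function of the table alone, to which the
  ergodic theorem applies.\<close>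

definition unseen_prob :: "nat \<Rightarrow> real" where
  "unseen_prob m = measure_pmf.expectation (markov_iterate kernel m empty_table)
     (\<lambda>T. measure_pmf.expectation (pmf_of_set \<Gamma>) (\<lambda>e. of_bool (full_table N k T \<and> \<not> seen k h s T e)))"

lemma valid_empty_table: "valid_table N k S empty_table"
  by (simp add: valid_table_def empty_table_def)

lemma valid_table_kernel:
  assumes "valid_table N k S T" "T' \<in> set_pmf (kernel T)"
  shows "valid_table N k S T'"
proof -
  obtain e out where "e \<in> \<Gamma>" "(out, T') \<in> set_pmf (qht_step k h s T e)"
    using assms(2) by (auto simp: kernel_def qht_kernel_def set_pmf_of_set \<Gamma>)
  then show ?thesis using valid_table_step[of k N S T h e s] k assms(1) h s by blast
qed

lemma valid_table_iterate:
  assumes "valid_table N k S T" "T' \<in> set_pmf (markov_iterate kernel m T)"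
  shows "valid_table N k S T'"
proof -
  have "set_pmf (markov_iterate kernel m T) \<subseteq> {T. valid_table N k S T}"
    by (rule set_markov_iterate_subset) (auto simp: assms(1) intro: valid_table_kernel)
  then show ?thesis using assms(2) by blast
qed

lemma convergent_mean_unseen_prob: "convergent (mean unseen_prob)"
  unfolding unseen_prob_def
proof (rule markov_mean_ergodic[OF finite_valid_tables, of N k S _ _ _ 1])
  show "\<bar>measure_pmf.expectation (pmf_of_set \<Gamma>) (\<lambda>e. of_bool (full_table N k T \<and> \<not> seen k h s T e) :: real)\<bar> \<le> 1" for T
    by (rule abs_expectation_le) simp
qed (auto simp: valid_empty_table intro: valid_table_kernel)

lemma full_prob_mono: "full_prob m \<le> full_prob (Suc m)"
  unfolding full_prob_def kernel_def by (rule prob_full_table_mono[OF k])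

text \<open>A row with an empty cell holds fewer than \<open>k \<le> S\<close> fingerprints, so some element would fill a cell;
  it arrives with probability at least \<open>1 / U\<close>.\<close>

lemma expectation_empty_cells_kernel:
  assumes pos: "\<And>r f. r < N \<Longrightarrow> f < S \<Longrightarrow> \<exists>e\<in>\<Gamma>. h e = r \<and> s e = f"
    and T: "valid_table N k S T"
  shows "measure_pmf.expectation (kernel T) (\<lambda>T. real (card (empty_cells N k T)))
    \<le> (1 - 1 / (real (card \<Gamma>) * real (N * k))) * real (card (empty_cells N k T))"
proof -
  let ?X = "\<lambda>T. real (card (empty_cells N k T))" and ?U = "real (card \<Gamma>)"
  have b: "\<bar>?X T\<bar> \<le> real (N * k)" for T using card_empty_cells_le[of N k T] by (simp flip: of_nat_mult)
  have U: "?U > 0" using \<Gamma> by (simp add: card_gt_0_iff)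
  have NK: "real (N * k) > 0" using N k by simp
  have E: "measure_pmf.expectation (kernel T) ?X =
      (\<Sum>e\<in>\<Gamma>. measure_pmf.expectation (qht_step k h s T e) (\<lambda>z. ?X (snd z))) / ?U"
    unfolding kernel_def by (subst expectation_qht_kernel[OF b]) (simp add: integral_pmf_of_set \<Gamma>)
  have le: "measure_pmf.expectation (qht_step k h s T e) (\<lambda>z. ?X (snd z)) \<le> ?X T - c"
    if "\<And>out T'. (out, T') \<in> set_pmf (qht_step k h s T e) \<Longrightarrow> ?X T' \<le> ?X T - c" for e c
  proof -
    have "measure_pmf.expectation (qht_step k h s T e) (\<lambda>z. ?X (snd z)) \<le>
      measure_pmf.expectation (qht_step k h s T e) (\<lambda>z. ?X T - c)"
      by (rule expectation_mono_pmf[where B = "real (N * k)" and C = "\<bar>?X T - c\<bar>"]) (use that b in auto)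
    then show ?thesis by simp
  qed
  have le0: "measure_pmf.expectation (qht_step k h s T e) (\<lambda>z. ?X (snd z)) \<le> ?X T" for e
  proof -
    have "?X T' \<le> ?X T - 0" if "(out, T') \<in> set_pmf (qht_step k h s T e)" for out T'
      using card_mono[OF finite_empty_cells empty_cells_step[OF k that]] by simp
    from le[OF this] show ?thesis by simp
  qed
  show ?thesis
  proof (cases "empty_cells N k T = {}")
    case True
    then have "(\<Sum>e\<in>\<Gamma>. measure_pmf.expectation (qht_step k h s T e) (\<lambda>z. ?X (snd z))) \<le> 0"
      using le0 by (intro sum_nonpos) simp
    then show ?thesis using True U by (simp add: E divide_nonpos_pos)
  next
    case False
    then obtain r c where rc: "r < N" "c < k" "T r c = None" by (auto simp: empty_cells_def)
    \<comment> \<open>The fingerprints in the other cells of the row. Empty cells add the arbitrary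
      value \<open>the None\<close>, which is harmless because only \<open>card F < k\<close> is
      used.\<close>
    define F where "F = (\<lambda>c'. the (T r c')) ` ({..<k} - {c})"
    have "card F < k"
      unfolding F_def using card_image_le[of "{..<k} - {c}" "\<lambda>c'. the (T r c')"] rc(2) by simp
    then have "\<not> {..<S} \<subseteq> F" using kS card_mono[of F "{..<S}"] by (auto simp: F_def)
    then obtain f where f: "f < S" "f \<notin> F" by auto
    obtain e where e: "e \<in> \<Gamma>" "h e = r" "s e = f" using pos[OF rc(1) f(1)] by blast
    have "\<not> seen k h s T e"
    proof
      assume "seen k h s T e"
      then obtain c' where "c' < k" "T r c' = Some f" by (auto simp: seen_def e)
      then show False using f(2) rc(3) unfolding F_def by force
    qed
    have "measure_pmf.expectation (qht_step k h s T e) (\<lambda>z. ?X (snd z)) \<le> ?X T - 1"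
    proof (rule le)
      fix out T' assume "(out, T') \<in> set_pmf (qht_step k h s T e)"
      from empty_cells_step_strict[OF k this _ \<open>\<not> seen k h s T e\<close>, of N]
      have "card (empty_cells N k T') < card (empty_cells N k T)"
        using rc e by (intro psubset_card_mono finite_empty_cells) auto
      then show "?X T' \<le> ?X T - 1" by linarith
    qed
    moreover have "(\<Sum>e\<in>\<Gamma> - {e}. measure_pmf.expectation (qht_step k h s T e) (\<lambda>z. ?X (snd z))) \<le>
        (\<Sum>e\<in>\<Gamma> - {e}. ?X T)" by (intro sum_mono le0)
    ultimately have "(\<Sum>e\<in>\<Gamma>. measure_pmf.expectation (qht_step k h s T e) (\<lambda>z. ?X (snd z))) \<le>
        (?X T - 1) + (\<Sum>e\<in>\<Gamma> - {e}. ?X T)"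
      by (subst sum.remove[OF \<Gamma>(1) e(1)]) simp
    also have "\<dots> = (\<Sum>e\<in>\<Gamma>. ?X T) - 1"
      by (subst sum.remove[OF \<Gamma>(1) e(1)]) simp
    also have "\<dots> = ?U * ?X T - 1" by simp
    finally have "measure_pmf.expectation (kernel T) ?X \<le> (?U * ?X T - 1) / ?U"
      unfolding E using U by (intro divide_right_mono) auto
    also have "\<dots> = ?X T - 1 / ?U" using U by (simp add: field_simps)
    \<comment> \<open>At most \<open>N * k\<close> cells are empty, so \<open>1\<close> is at least
      \<open>?X T / real (N * k)\<close>; this turns the additive decrease into a
      contraction.\<close>
    also have "\<dots> \<le> ?X T - (?X T / real (N * k)) / ?U"
      using b[of T] NK U by (intro diff_left_mono divide_right_mono) (auto simp: field_simps)
    also have "\<dots> = (1 - 1 / (?U * real (N * k))) * ?X T"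
      using U NK by (simp add: field_simps)
    finally show ?thesis .
  qed
qed

text \<open>The expected number of empty cells contracts by the factor \<rho> at each step. A table
  that is not full has at least one empty cell, so this expectation bounds the probability of not
  being full.\<close>

lemma full_prob_ge:
  assumes pos: "\<And>r f. r < N \<Longrightarrow> f < S \<Longrightarrow> \<exists>e\<in>\<Gamma>. h e = r \<and> s e = f"
  shows "full_prob m \<ge> 1 - real (N * k) * (1 - 1 / (real (card \<Gamma>) * real (N * k))) ^ m"
proof -
  let ?X = "\<lambda>T. real (card (empty_cells N k T))"
  define \<rho> where "\<rho> = 1 - 1 / (real (card \<Gamma>) * real (N * k))"
  have b: "\<bar>?X T\<bar> \<le> real (N * k)" for T using card_empty_cells_le[of N k T] by (simp flip: of_nat_mult)
  have "card \<Gamma> \<ge> 1" using \<Gamma> by (simp add: Suc_le_eq card_gt_0_iff)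
  then have "card \<Gamma> * (N * k) \<ge> 1" using N k by (simp add: Suc_le_eq)
  then have "real (card \<Gamma>) * real (N * k) \<ge> 1" by (metis of_nat_1 of_nat_le_iff of_nat_mult)
  then have \<rho>: "\<rho> \<ge> 0" by (simp add: \<rho>_def)
  have X: "measure_pmf.expectation (markov_iterate kernel m T) ?X \<le> \<rho> ^ m * ?X T" if "valid_table N k S T" for T
    using that
  proof (induction m arbitrary: T)
    case (Suc m)
    have "measure_pmf.expectation (markov_iterate kernel (Suc m) T) ?X =
        measure_pmf.expectation (kernel T) (\<lambda>T'. measure_pmf.expectation (markov_iterate kernel m T') ?X)"
      by (simp del: of_nat_mult) (rule expectation_bind_pmf_bounded, rule b)
    also have "\<dots> \<le> measure_pmf.expectation (kernel T) (\<lambda>T'. \<rho> ^ m * ?X T')"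
    proof (rule expectation_mono_pmf)
      show "\<bar>measure_pmf.expectation (markov_iterate kernel m T') ?X\<bar> \<le> real (N * k)" for T'
        by (rule abs_expectation_le) (rule b)
      show "\<bar>\<rho> ^ m * ?X T'\<bar> \<le> \<rho> ^ m * real (N * k)" for T'
        using \<rho> b[of T'] by (simp add: abs_mult mult_left_mono)
    qed (rule Suc.IH[OF valid_table_kernel[OF Suc.prems]])
    also have "\<dots> = \<rho> ^ m * measure_pmf.expectation (kernel T) ?X" by simp
    also have "\<dots> \<le> \<rho> ^ m * (\<rho> * ?X T)"
      using \<rho> expectation_empty_cells_kernel[OF pos Suc.prems] by (intro mult_left_mono) (auto simp: \<rho>_def)
    finally show ?case by (simp add: mult_ac)
  qed simp
  have "1 - full_prob m = measure_pmf.expectation (markov_iterate kernel m empty_table) (\<lambda>T. 1 - of_bool (full_table N k T))"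
    unfolding full_prob_def
    by (subst Bochner_Integration.integral_diff) (auto intro: integrable_measure_pmf_bounded[of _ _ 1])
  also have "\<dots> \<le> measure_pmf.expectation (markov_iterate kernel m empty_table) ?X"
  proof (rule expectation_mono_pmf[where B = 1])
    fix T show "1 - of_bool (full_table N k T) \<le> ?X T"
      using finite_empty_cells[of N k T] by (auto simp: full_table_iff Suc_le_eq card_gt_0_iff)
    show "\<bar>?X T\<bar> \<le> real (N * k)" by (rule b)
  qed simp
  also have "\<dots> \<le> \<rho> ^ m * ?X empty_table" by (rule X[OF valid_empty_table])
  also have "\<dots> \<le> \<rho> ^ m * real (N * k)" using \<rho> b[of empty_table] by (intro mult_left_mono) auto
  finally show ?thesis by (simp add: \<rho>_def mult.commute)
qed

lemma unseen_prob_close: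
  assumes good: "\<And>r f. r < N \<Longrightarrow> f < S \<Longrightarrow>
      \<bar>real (card {e\<in>\<Gamma>. h e = r \<and> s e = f}) / real (card \<Gamma>) - 1 / real (N * S)\<bar> \<le> \<epsilon>"
    and \<epsilon>: "\<epsilon> \<ge> 0"
  shows "\<bar>unseen_prob m - (1 - real k / real S) * full_prob m\<bar> \<le> real (N * k) * \<epsilon>"
proof -
  let ?U = "real (card \<Gamma>)" and ?q = "1 - real k / real S"
  let ?u = "\<lambda>T. measure_pmf.expectation (pmf_of_set \<Gamma>) (\<lambda>e. of_bool (full_table N k T \<and> \<not> seen k h s T e) :: real)"
  have U: "?U > 0" using \<Gamma> by (simp add: card_gt_0_iff)
  have point: "\<bar>?u T - ?q * of_bool (full_table N k T)\<bar> \<le> real (N * k) * \<epsilon>" if T: "valid_table N k S T" for T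
  proof (cases "full_table N k T")
    case False
    then show ?thesis using \<epsilon> by simp
  next
    case True
    \<comment> \<open>The elements recognised by one cell. Different rows give disjoint classes
      because \<open>h\<close> differs, different cells of one row because their fingerprints
      differ.\<close>
    define C where "C = (\<lambda>(r, c). {e\<in>\<Gamma>. h e = r \<and> s e = the (T r c)})"
    have Some: "T r c = Some (the (T r c))" if "r < N" "c < k" for r c
      using True that by (auto simp: full_table_def)
    have "{e\<in>\<Gamma>. seen k h s T e} = (\<Union>x\<in>{..<N} \<times> {..<k}. C x)"
      using h Some by (force simp: seen_def C_def)
    moreover have "C x \<inter> C y = {}" if "x \<in> {..<N} \<times> {..<k}" "y \<in> {..<N} \<times> {..<k}" "x \<noteq> y" for x y
    proof (rule ccontr)
      assume "C x \<inter> C y \<noteq> {}"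
      then obtain e where e: "h e = fst x" "h e = fst y" "s e = the (T (fst x) (snd x))" "s e = the (T (fst y) (snd y))"
        by (auto simp: C_def case_prod_unfold)
      then have "T (fst x) (snd x) = Some (s e)" "T (fst x) (snd y) = Some (s e)"
        using that(1,2) Some[of "fst x" "snd x"] Some[of "fst y" "snd y"] by (auto simp: mem_Times_iff)
      then have "snd x = snd y" using T unfolding valid_table_def by blast
      with e that(3) show False by (simp add: prod_eq_iff)
    qed
    ultimately have card: "card {e\<in>\<Gamma>. seen k h s T e} = (\<Sum>x\<in>{..<N} \<times> {..<k}. card (C x))"
      using \<Gamma>(1) by (subst card_UN_disjoint[symmetric]) (auto simp: C_def case_prod_unfold)
    have "?u T = real (card {e\<in>\<Gamma>. \<not> seen k h s T e}) / ?U"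
      using True by (simp add: integral_pmf_of_set \<Gamma> sum.If_cases of_bool_def Collect_conj_eq)
    also have "real (card {e\<in>\<Gamma>. \<not> seen k h s T e}) = ?U - real (card {e\<in>\<Gamma>. seen k h s T e})"
    proof -
      have "\<Gamma> = {e\<in>\<Gamma>. seen k h s T e} \<union> {e\<in>\<Gamma>. \<not> seen k h s T e}" by auto
      then have "card \<Gamma> = card {e\<in>\<Gamma>. seen k h s T e} + card {e\<in>\<Gamma>. \<not> seen k h s T e}"
        using \<Gamma>(1) by (subst (1) card_Un_disjoint[symmetric]) auto
      then show ?thesis by simp
    qed
    also have "(?U - real (card {e\<in>\<Gamma>. seen k h s T e})) / ?U = 1 - (\<Sum>x\<in>{..<N} \<times> {..<k}. real (card (C x)) / ?U)"
      using U by (simp add: card sum_divide_distrib[symmetric] diff_divide_distrib)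
    \<comment> \<open>The ideal value \<open>1 / (N * S)\<close>, summed over the
      \<open>N * k\<close> cells, is \<open>k / S\<close>; what remains is one deviation per
      cell.\<close>
    also have "\<dots> = ?q - (\<Sum>x\<in>{..<N} \<times> {..<k}. real (card (C x)) / ?U - 1 / real (N * S))"
    proof -
      have "(\<Sum>x\<in>{..<N} \<times> {..<k}. 1 / real (N * S)) = real k / real S"
        using N by (simp add: card_cartesian_product)
      then show ?thesis by (simp only: sum_subtractf)
    qed
    finally have "\<bar>?u T - ?q * of_bool (full_table N k T)\<bar> =
        \<bar>\<Sum>x\<in>{..<N} \<times> {..<k}. real (card (C x)) / ?U - 1 / real (N * S)\<bar>" using True by simp
    also have "\<dots> \<le> (\<Sum>x\<in>{..<N} \<times> {..<k}. \<bar>real (card (C x)) / ?U - 1 / real (N * S)\<bar>)" by (rule sum_abs)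
    also have "\<dots> \<le> (\<Sum>x\<in>{..<N} \<times> {..<k}. \<epsilon>)"
    proof (rule sum_mono)
      fix x assume "x \<in> {..<N} \<times> {..<k}"
      then have "fst x < N" "the (T (fst x) (snd x)) < S"
        using T Some[of "fst x" "snd x"] unfolding valid_table_def by auto
      from good[OF this] show "\<bar>real (card (C x)) / ?U - 1 / real (N * S)\<bar> \<le> \<epsilon>"
        by (simp add: C_def case_prod_unfold)
    qed
    also have "\<dots> = real (N * k) * \<epsilon>" by (simp add: card_cartesian_product)
    finally show ?thesis .
  qed
  have ub: "\<bar>?u T\<bar> \<le> 1" for T by (rule abs_expectation_le) simp
  have "unseen_prob m - ?q * full_prob m = measure_pmf.expectation (markov_iterate kernel m empty_table)
      (\<lambda>T. ?u T - ?q * of_bool (full_table N k T))"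
    unfolding unseen_prob_def full_prob_def
    by (subst Bochner_Integration.integral_diff)
       (auto intro!: integrable_measure_pmf_bounded[of _ _ 1] integrable_mult_right ub)
  also have "\<bar>\<dots>\<bar> \<le> real (N * k) * \<epsilon>"
    by (rule abs_expectation_le) (rule point[OF valid_table_iterate[OF valid_empty_table]])
  finally show ?thesis .
qed

lemma full_prob_bounds: "0 \<le> full_prob m" "full_prob m \<le> 1"
proof -
  show "0 \<le> full_prob m" unfolding full_prob_def by (rule Bochner_Integration.integral_nonneg) simp
  have "\<bar>full_prob m\<bar> \<le> 1" unfolding full_prob_def by (rule abs_expectation_le) simp
  then show "full_prob m \<le> 1" by simp
qed

lemma unseen_prob_bounds: "0 \<le> unseen_prob m" "unseen_prob m \<le> 1"
proof -
  show "0 \<le> unseen_prob m" unfolding unseen_prob_def by (intro Bochner_Integration.integral_nonneg) simp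
  have "\<bar>unseen_prob m\<bar> \<le> 1" unfolding unseen_prob_def by (intro abs_expectation_le) simp
  then show "unseen_prob m \<le> 1" by simp
qed

end

section \<open>Random hash and fingerprint functions\<close>

lemma bool_pmf_eq_bernoulli:
  assumes "pmf q True = p"
  shows "q = bernoulli_pmf p"
proof (rule pmf_eqI)
  have p: "0 \<le> p" "p \<le> 1" using assms by (auto simp: pmf_le_1 simp flip: assms)
  fix b show "pmf q b = pmf (bernoulli_pmf p) b"
    using p assms by (cases b) (simp_all add: pmf_False_conv_True)
qed

lemma expectation_of_bool:
  "measure_pmf.expectation p (\<lambda>x. of_bool (P x)) = measure_pmf.prob p {x. P x}"
proof -
  have "(\<lambda>x. of_bool (P x) :: real) = indicator {x. P x}" by (auto simp: indicator_def)
  then show ?thesis by simp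
qed

text \<open>Each of the \<open>m\<close> independent draws avoids \<open>e\<close> with probability
  \<open>1 - 1 / U\<close>, where \<open>U\<close> is the size of the alphabet.\<close>

lemma prob_unseen_element:
  assumes "finite \<Gamma>" "e \<in> \<Gamma>"
  shows "measure_pmf.expectation (replicate_pmf m (pmf_of_set \<Gamma>)) (\<lambda>es. of_bool (e \<notin> set es))
    = (1 - 1 / real (card \<Gamma>)) ^ m"
proof (induction m)
  case (Suc m)
  have ne: "\<Gamma> \<noteq> {}" using assms by auto
  have U: "card \<Gamma> > 0" using assms by (auto simp: card_gt_0_iff)
  have "measure_pmf.expectation (replicate_pmf (Suc m) (pmf_of_set \<Gamma>)) (\<lambda>es. of_bool (e \<notin> set es) :: real)
    = measure_pmf.expectation (pmf_of_set \<Gamma>) (\<lambda>x. measure_pmf.expectation (replicate_pmf m (pmf_of_set \<Gamma>))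
        (\<lambda>es. of_bool (e \<noteq> x) * of_bool (e \<notin> set es)))"
    unfolding replicate_pmf.simps
    by (subst expectation_bind_pmf_bounded[where B = 1], simp,
        subst expectation_bind_pmf_bounded[where B = 1], simp) (simp add: of_bool_conj)
  also have "\<dots> = measure_pmf.expectation (pmf_of_set \<Gamma>) (\<lambda>x. of_bool (e \<noteq> x) * (1 - 1 / real (card \<Gamma>)) ^ m)"
    by (simp add: Suc)
  also have "\<dots> = measure_pmf.prob (pmf_of_set \<Gamma>) {x. e \<noteq> x} * (1 - 1 / real (card \<Gamma>)) ^ m"
    by (simp add: expectation_of_bool)
  also have "measure_pmf.prob (pmf_of_set \<Gamma>) {x. e \<noteq> x} = real (card (\<Gamma> - {e})) / real (card \<Gamma>)"
    by (subst measure_pmf_of_set[OF ne assms(1)], rule arg_cong2[where f = "\<lambda>A B. real (card A) / B"]) auto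
  also have "\<dots> = 1 - 1 / real (card \<Gamma>)"
    using assms U ne by (simp add: card_Diff_singleton of_nat_diff diff_divide_distrib)
  finally show ?case by simp
qed simp

section \<open>Bucket sizes under random hashing and the law of the experiment\<close>

context qht
begin

definition hash_pmf :: "(('a \<Rightarrow> nat) \<times> ('a \<Rightarrow> nat)) pmf" where
  "hash_pmf = pair_pmf (pmf_of_set (\<Gamma> \<rightarrow>\<^sub>E {..<N})) (pmf_of_set (\<Gamma> \<rightarrow>\<^sub>E {..<S}))"

lemma lessThan_nonempty: "{..<N} \<noteq> {}" "{..<S} \<noteq> {}"
  using N k kS by (auto simp: lessThan_empty_iff)

lemma hash_function_sets:
  "finite (\<Gamma> \<rightarrow>\<^sub>E {..<N})" "\<Gamma> \<rightarrow>\<^sub>E {..<N} \<noteq> {}"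
  "finite (\<Gamma> \<rightarrow>\<^sub>E {..<S})" "\<Gamma> \<rightarrow>\<^sub>E {..<S} \<noteq> {}"
  using lessThan_nonempty \<Gamma> by (auto intro!: finite_PiE simp: PiE_eq_empty_iff)

lemma finite_set_hash_pmf: "finite (set_pmf hash_pmf)"
  by (simp add: hash_pmf_def hash_function_sets)

lemma qht_hashed_hash_pmf: "(h, s) \<in> set_pmf hash_pmf \<Longrightarrow> qht_hashed N k S \<Gamma> h s"
  by unfold_locales (auto simp: hash_pmf_def hash_function_sets dest: PiE_mem)

text \<open>A uniformly random function has independent uniform values. Hence each element hits the
  pair \<open>(r, f)\<close> independently with probability \<open>1 / (N * S)\<close>, and the
  number of hits is binomial.\<close>

lemma bucket_size_distribution:
  assumes "r < N" "f < S"
  shows "map_pmf (\<lambda>(h, s). card {e\<in>\<Gamma>. h e = r \<and> s e = f}) hash_pmf = binomial_pmf (card \<Gamma>) (1 / real (N * S))"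
proof -
  \<comment> \<open>Extensional functions take the value \<open>undefined\<close> outside their
    domain, so with this default \<open>Pi_pmf\<close> and the uniform law on functions
    agree.\<close>
  have dflt: "PiE_dflt \<Gamma> undefined (\<lambda>_. B) = \<Gamma> \<rightarrow>\<^sub>E B" for B :: "nat set"
    by (auto simp: PiE_dflt_def PiE_def extensional_def)
  have Pi: "Pi_pmf \<Gamma> undefined (\<lambda>_. pmf_of_set B) = pmf_of_set (\<Gamma> \<rightarrow>\<^sub>E B)" if "finite B" "B \<noteq> {}" for B :: "nat set"
    using Pi_pmf_of_set[of \<Gamma> "\<lambda>_. B" undefined] that \<Gamma> by (simp add: dflt)
  have NS: "N > 0" "S > 0" using N k kS by auto
  have bern: "bind_pmf (pmf_of_set {..<N}) (\<lambda>r'. bind_pmf (pmf_of_set {..<S}) (\<lambda>f'. return_pmf (r' = r \<and> f' = f)))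
      = bernoulli_pmf (1 / real (N * S))" (is "?b = _")
  proof (rule bool_pmf_eq_bernoulli)
    have "pmf ?b True = (\<Sum>r'<N. (\<Sum>f'<S. of_bool (r' = r) * of_bool (f' = f)) / real S) / real N"
      using NS by (simp add: pmf_bind_pmf_of_set lessThan_nonempty)
        (auto intro!: sum.cong simp: indicator_def)
    also have "\<dots> = 1 / real (N * S)"
      using assms by (simp add: sum_distrib_left[symmetric] sum_divide_distrib[symmetric] of_bool_def sum.delta')
    finally show "pmf ?b True = 1 / real (N * S)" .
  qed
  have "Pi_pmf \<Gamma> False (\<lambda>_. bernoulli_pmf (1 / real (N * S))) =
      bind_pmf (pmf_of_set (\<Gamma> \<rightarrow>\<^sub>E {..<N})) (\<lambda>h. bind_pmf (pmf_of_set (\<Gamma> \<rightarrow>\<^sub>E {..<S}))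
        (\<lambda>s. return_pmf (\<lambda>e. if e \<in> \<Gamma> then h e = r \<and> s e = f else False)))"
    unfolding bern[symmetric]
    by (subst Pi_pmf_bind[OF \<Gamma>(1), where d' = undefined], subst Pi_pmf_bind[OF \<Gamma>(1), where d' = undefined])
       (simp add: Pi lessThan_nonempty \<Gamma>)
  moreover have "binomial_pmf (card \<Gamma>) (1 / real (N * S)) =
      map_pmf (\<lambda>v. card {e\<in>\<Gamma>. v e}) (Pi_pmf \<Gamma> False (\<lambda>_. bernoulli_pmf (1 / real (N * S))))"
  proof (rule binomial_pmf_altdef'[OF \<Gamma>(1) refl])
    have "1 \<le> N * S" using NS by (simp add: Suc_le_eq)
    then have "1 \<le> real (N * S)" by (metis of_nat_1 of_nat_le_iff)
    then show "1 / real (N * S) \<in> {0..1}" by simp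
  qed
  ultimately show ?thesis
    by (simp add: hash_pmf_def pair_pmf_def map_bind_pmf bind_assoc_pmf bind_return_pmf map_pmf_def
        cong: conj_cong)
qed

text \<open>The inequality is not strict, so outside this set deviations are strictly below
  \<epsilon>; with \<epsilon> at most \<open>1 / (N * S)\<close>, every pair is then
  attained.\<close>

definition unbalanced :: "real \<Rightarrow> (('a \<Rightarrow> nat) \<times> ('a \<Rightarrow> nat)) set" where
  "unbalanced \<epsilon> = {(h, s). \<exists>r<N. \<exists>f<S.
     \<bar>real (card {e\<in>\<Gamma>. h e = r \<and> s e = f}) / real (card \<Gamma>) - 1 / real (N * S)\<bar> \<ge> \<epsilon>}"

text \<open>Hoeffding's inequality for each binomial bucket size, and a union bound over the
  \<open>N * S\<close> pairs.\<close>

lemma prob_unbalanced_le: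
  assumes "\<epsilon> \<ge> 0"
  shows "measure_pmf.prob hash_pmf (unbalanced \<epsilon>) \<le> real (N * S) * (2 * exp (- 2 * real (card \<Gamma>) * \<epsilon>\<^sup>2))"
proof -
  define E where "E = (\<lambda>(r, f). {hs :: ('a \<Rightarrow> nat) \<times> ('a \<Rightarrow> nat). \<bar>real (card {e\<in>\<Gamma>. fst hs e = r \<and> snd hs e = f}) / real (card \<Gamma>) - 1 / real (N * S)\<bar> \<ge> \<epsilon>})"
  have "1 \<le> N * S" using N k kS by (simp add: Suc_le_eq)
  then have "1 \<le> real (N * S)" by (metis of_nat_1 of_nat_le_iff)
  then interpret binomial_distribution "card \<Gamma>" "1 / real (N * S)" by unfold_locales simp
  have E: "measure_pmf.prob hash_pmf (E x) \<le> 2 * exp (- 2 * real (card \<Gamma>) * \<epsilon>\<^sup>2)" if "x \<in> {..<N} \<times> {..<S}" for x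
  proof -
    have "measure_pmf.prob hash_pmf (E x) = measure_pmf.prob (map_pmf (\<lambda>(h, s). card {e\<in>\<Gamma>. h e = fst x \<and> s e = snd x}) hash_pmf)
        {n. \<bar>real n / real (card \<Gamma>) - 1 / real (N * S)\<bar> \<ge> \<epsilon>}"
      by (simp add: E_def case_prod_unfold vimage_def)
    also have "\<dots> = measure_pmf.prob (binomial_pmf (card \<Gamma>) (1 / real (N * S)))
        {n. \<bar>real n / real (card \<Gamma>) - 1 / real (N * S)\<bar> \<ge> \<epsilon>}"
      using that by (subst bucket_size_distribution) auto
    also have "\<dots> \<le> 2 * exp (- 2 * real (card \<Gamma>) * \<epsilon>\<^sup>2)"
      using prob_abs_ge'[OF _ assms] \<Gamma> by (simp add: card_gt_0_iff)
    finally show ?thesis .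
  qed
  have "unbalanced \<epsilon> = (\<Union>x\<in>{..<N} \<times> {..<S}. E x)"
    by (auto simp: unbalanced_def E_def) blast
  then have "measure_pmf.prob hash_pmf (unbalanced \<epsilon>) \<le> (\<Sum>x\<in>{..<N} \<times> {..<S}. measure_pmf.prob hash_pmf (E x))"
    by (simp add: measure_UNION_le)
  also have "\<dots> \<le> (\<Sum>x\<in>{..<N} \<times> {..<S}. 2 * exp (- 2 * real (card \<Gamma>) * \<epsilon>\<^sup>2))"
    by (intro sum_mono E)
  finally show ?thesis by (simp add: card_cartesian_product)
qed

lemma expectation_qht_experiment:
  assumes "\<And>T out. \<bar>f T out :: real\<bar> \<le> B"
  shows "measure_pmf.expectation (qht_experiment N k S \<Gamma> m) (\<lambda>(es, T, e, out). f T out) =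
    measure_pmf.expectation hash_pmf (\<lambda>(h, s).
      measure_pmf.expectation (markov_iterate (qht_kernel k h s (pmf_of_set \<Gamma>)) m empty_table) (\<lambda>T.
        measure_pmf.expectation (pmf_of_set \<Gamma>) (\<lambda>e.
          measure_pmf.expectation (qht_step k h s T e) (\<lambda>z. f T (fst z)))))"
proof -
  have "map_pmf (\<lambda>(es, T, e, out). (T, out)) (qht_experiment N k S \<Gamma> m) =
      bind_pmf hash_pmf (\<lambda>(h, s). bind_pmf (markov_iterate (qht_kernel k h s (pmf_of_set \<Gamma>)) m empty_table)
        (\<lambda>T. bind_pmf (pmf_of_set \<Gamma>) (\<lambda>e. map_pmf (\<lambda>z. (T, fst z)) (qht_step k h s T e))))"
    by (simp add: qht_experiment_def hash_pmf_def pair_pmf_def map_pmf_def bind_assoc_pmf bind_return_pmf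
        case_prod_unfold replicate_qht_run_eq_markov_iterate[symmetric])
  from arg_cong[OF this, of "\<lambda>p. measure_pmf.expectation p (\<lambda>(T, out). f T out)"]
  have "measure_pmf.expectation (qht_experiment N k S \<Gamma> m) (\<lambda>(es, T, e, out). f T out) =
    measure_pmf.expectation (bind_pmf hash_pmf (\<lambda>(h, s). bind_pmf (markov_iterate (qht_kernel k h s (pmf_of_set \<Gamma>)) m empty_table)
        (\<lambda>T. bind_pmf (pmf_of_set \<Gamma>) (\<lambda>e. map_pmf (\<lambda>z. (T, fst z)) (qht_step k h s T e))))) (\<lambda>(T, out). f T out)"
    by (simp add: case_prod_unfold)
  also have "\<dots> = measure_pmf.expectation hash_pmf (\<lambda>(h, s).
      measure_pmf.expectation (markov_iterate (qht_kernel k h s (pmf_of_set \<Gamma>)) m empty_table) (\<lambda>T.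
        measure_pmf.expectation (pmf_of_set \<Gamma>) (\<lambda>e.
          measure_pmf.expectation (qht_step k h s T e) (\<lambda>z. f T (fst z)))))"
    by (simp add: expectation_bind_pmf_bounded[where B = B] assms case_prod_unfold)
  finally show ?thesis .
qed

definition full_table_prob :: "nat \<Rightarrow> real" where
  "full_table_prob m = measure_pmf.expectation hash_pmf (\<lambda>(h, s). qht_hashed.full_prob N k \<Gamma> h s m)"

definition unseen_full_prob :: "nat \<Rightarrow> real" where
  "unseen_full_prob m = measure_pmf.expectation hash_pmf (\<lambda>(h, s). qht_hashed.unseen_prob N k \<Gamma> h s m)"

lemma prob_experiment_full:
  "measure_pmf.prob (qht_experiment N k S \<Gamma> m) {(es, T, e, out). full_table N k T} = full_table_prob m"
proof -
  have "measure_pmf.prob (qht_experiment N k S \<Gamma> m) {(es, T, e, out). full_table N k T} =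
    measure_pmf.expectation (qht_experiment N k S \<Gamma> m) (\<lambda>(es, T, e, out). of_bool (full_table N k T))"
    by (simp add: case_prod_unfold expectation_of_bool)
  also have "\<dots> = full_table_prob m"
    unfolding full_table_prob_def
    by (subst expectation_qht_experiment[where B = 1], simp, rule expectation_cong_pmf)
       (auto simp: qht_hashed.full_prob_def[OF qht_hashed_hash_pmf] qht_hashed.kernel_def[OF qht_hashed_hash_pmf])
  finally show ?thesis .
qed

lemma expectation_unseen_step:
  "measure_pmf.expectation (qht_step k h s T e) (\<lambda>z. of_bool (fst z = UNSEEN \<and> P) :: real) =
    of_bool (P \<and> \<not> seen k h s T e)"
proof -
  have "measure_pmf.expectation (qht_step k h s T e) (\<lambda>z. of_bool (fst z = UNSEEN \<and> P) :: real) =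
    measure_pmf.expectation (qht_step k h s T e) (\<lambda>z. of_bool (P \<and> \<not> seen k h s T e))"
    by (rule expectation_cong_pmf) (use set_qht_step[OF k, of _ _ h s T e] in fastforce)
  then show ?thesis by simp
qed

lemma prob_experiment_unseen:
  "measure_pmf.prob (qht_experiment N k S \<Gamma> m) {(es, T, e, out). out = UNSEEN \<and> full_table N k T} = unseen_full_prob m"
proof -
  have "measure_pmf.prob (qht_experiment N k S \<Gamma> m) {(es, T, e, out). out = UNSEEN \<and> full_table N k T} =
    measure_pmf.expectation (qht_experiment N k S \<Gamma> m) (\<lambda>(es, T, e, out). of_bool (out = UNSEEN \<and> full_table N k T))"
    by (simp add: case_prod_unfold expectation_of_bool)
  also have "\<dots> = unseen_full_prob m"
    unfolding unseen_full_prob_def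
    by (subst expectation_qht_experiment[where B = 1], simp, rule expectation_cong_pmf)
       (auto simp: expectation_unseen_step qht_hashed.unseen_prob_def[OF qht_hashed_hash_pmf] qht_hashed.kernel_def[OF qht_hashed_hash_pmf])
  finally show ?thesis .
qed

text \<open>Discarding hashes, table and output leaves \<open>m\<close> draws and an independent
  further one, and for each value of the latter the probability of missing it is the same.\<close>

lemma prob_experiment_not_duplicate:
  "measure_pmf.prob (qht_experiment N k S \<Gamma> m) {(es, T, e, out). e \<notin> set es} = (1 - 1 / real (card \<Gamma>)) ^ m"
proof -
  have "map_pmf (\<lambda>(es, T, e, out). (es, e)) (qht_experiment N k S \<Gamma> m) =
      bind_pmf (pmf_of_set \<Gamma>) (\<lambda>e. map_pmf (\<lambda>es. (es, e)) (replicate_pmf m (pmf_of_set \<Gamma>)))"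
    unfolding map_pmf_def by (subst bind_commute_pmf)
      (simp add: qht_experiment_def bind_assoc_pmf bind_return_pmf case_prod_unfold)
  from arg_cong[OF this, of "\<lambda>p. measure_pmf.expectation p (\<lambda>(es, e). of_bool (e \<notin> set es) :: real)"]
  have "measure_pmf.expectation (qht_experiment N k S \<Gamma> m) (\<lambda>(es, T, e, out). of_bool (e \<notin> set es) :: real) =
     measure_pmf.expectation (bind_pmf (pmf_of_set \<Gamma>) (\<lambda>e. map_pmf (\<lambda>es. (es, e)) (replicate_pmf m (pmf_of_set \<Gamma>))))
       (\<lambda>(es, e). of_bool (e \<notin> set es))"
    by (simp add: case_prod_unfold)
  also have "\<dots> = measure_pmf.expectation (pmf_of_set \<Gamma>) (\<lambda>e. (1 - 1 / real (card \<Gamma>)) ^ m)"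
    by (subst expectation_bind_pmf_bounded[where B = 1], simp add: case_prod_unfold, rule expectation_cong_pmf)
       (simp add: prob_unseen_element \<Gamma>)
  finally show ?thesis by (simp add: case_prod_unfold expectation_of_bool)
qed

end

text \<open>With \<open>D\<close> the event that the next element is a duplicate, this bounds the
  cost of dropping that condition from the numerator and the denominator of
  \<open>FN\<close>.\<close>

lemma abs_prob_Int_diff_le:
  "\<bar>measure_pmf.prob p (A \<inter> D) - measure_pmf.prob p A\<bar> \<le> measure_pmf.prob p (- D)"
proof -
  have "measure_pmf.prob p A \<le> measure_pmf.prob p ((A \<inter> D) \<union> - D)"
    by (rule measure_pmf.finite_measure_mono) auto
  also have "\<dots> \<le> measure_pmf.prob p (A \<inter> D) + measure_pmf.prob p (- D)"
    by (rule measure_Un_le) auto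
  finally show ?thesis
    using measure_pmf.finite_measure_mono[of "A \<inter> D" A p] by simp
qed

section \<open>The false negative rate and its limits\<close>

context qht
begin

lemma full_table_prob_mono: "full_table_prob m \<le> full_table_prob (Suc m)"
  unfolding full_table_prob_def
proof (rule integral_mono_AE)
  show "AE hs in hash_pmf. (case hs of (h, s) \<Rightarrow> qht_hashed.full_prob N k \<Gamma> h s m)
      \<le> (case hs of (h, s) \<Rightarrow> qht_hashed.full_prob N k \<Gamma> h s (Suc m))"
    using qht_hashed.full_prob_mono[OF qht_hashed_hash_pmf] by (simp add: AE_measure_pmf_iff split_beta)
qed (intro integrable_measure_pmf_finite finite_set_hash_pmf)+

lemma full_table_prob_bounds: "0 \<le> full_table_prob m" "full_table_prob m \<le> 1"
  unfolding prob_experiment_full[symmetric] by auto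

lemma abs_unseen_full_prob_le: "\<bar>unseen_full_prob m\<bar> \<le> 1"
  unfolding prob_experiment_unseen[symmetric] by simp

text \<open>That the limit is also an upper bound settles the degenerate case \<open>p = 0\<close>,
  where every term must vanish.\<close>

lemma full_table_prob_limit:
  obtains p where "full_table_prob \<longlonglongrightarrow> p" "\<And>m. full_table_prob m \<le> p"
proof -
  have inc: "incseq full_table_prob" by (rule incseq_SucI) (rule full_table_prob_mono)
  obtain p where p: "full_table_prob \<longlonglongrightarrow> p"
    by (rule incseq_convergent[OF inc, of 1]) (use full_table_prob_bounds(2) in blast)+
  show ?thesis by (rule that[OF p incseq_le[OF inc p]])
qed

text \<open>The hash functions are drawn once, so the table follows a finite mixture of Markov
  chains, each with convergent means.\<close>

lemma convergent_mean_unseen_full_prob: "convergent (mean unseen_full_prob)"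
proof -
  have "unseen_full_prob = (\<lambda>m. \<Sum>hs\<in>set_pmf hash_pmf. pmf hash_pmf hs * (case hs of (h, s) \<Rightarrow> qht_hashed.unseen_prob N k \<Gamma> h s m))"
    unfolding unseen_full_prob_def
    by (rule ext, subst integral_measure_pmf_real[OF finite_set_hash_pmf]) (auto simp: mult.commute)
  from arg_cong[OF this, of mean]
  have eq: "mean unseen_full_prob = (\<lambda>n. \<Sum>hs\<in>set_pmf hash_pmf. pmf hash_pmf hs *
      mean (\<lambda>m. case hs of (h, s) \<Rightarrow> qht_hashed.unseen_prob N k \<Gamma> h s m) n)"
    by (intro ext) (simp only: mean_sum mean_cmult)
  show ?thesis
    unfolding eq
  proof (intro convergent_sum convergent_mult convergent_const)
    fix hs assume "hs \<in> set_pmf hash_pmf"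
    then show "convergent (mean (\<lambda>m. case hs of (h, s) \<Rightarrow> qht_hashed.unseen_prob N k \<Gamma> h s m))"
      using qht_hashed.convergent_mean_unseen_prob[OF qht_hashed_hash_pmf] by (cases hs) auto
  qed
qed

text \<open>Isolates the duplicate event as an intersection factor, the shape expected by
  \<open>abs_prob_Int_diff_le\<close>.\<close>

lemma FN_eq:
  "FN N k S \<Gamma> m =
    measure_pmf.prob (qht_experiment N k S \<Gamma> m)
      ({(es, T, e, out). out = UNSEEN \<and> full_table N k T} \<inter> {(es, T, e, out). e \<in> set es}) /
    measure_pmf.prob (qht_experiment N k S \<Gamma> m)
      ({(es, T, e, out). full_table N k T} \<inter> {(es, T, e, out). e \<in> set es})"
  unfolding FN_def cond_prob_def
  by (intro arg_cong2[where f = "(/)"] arg_cong[where f = "measure_pmf.prob (qht_experiment N k S \<Gamma> m)"]) auto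

lemma FNR_tendsto:
  assumes p: "full_table_prob \<longlonglongrightarrow> p" "p > 0" and \<alpha>: "mean unseen_full_prob \<longlonglongrightarrow> \<alpha>"
  shows "FNR N k S \<Gamma> \<longlonglongrightarrow> \<alpha> / p"
proof -
  have "card \<Gamma> \<ge> 1" using \<Gamma> by (simp add: Suc_le_eq card_gt_0_iff)
  then have \<delta>: "(\<lambda>m. (1 - 1 / real (card \<Gamma>)) ^ m) \<longlonglongrightarrow> 0"
    by (intro LIMSEQ_power_zero) (simp add: field_simps)
  have compl: "- {(es, T, e, out). e \<in> set es} = {(es, T, e, out). e \<notin> set es}" by auto
  have "FNR N k S \<Gamma> = mean (FN N k S \<Gamma>)" by (simp add: FNR_def mean_def fun_eq_iff)
  also have "\<dots> \<longlonglongrightarrow> \<alpha> / p"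
    unfolding FN_eq[abs_def]
  proof (rule mean_quotient_tendsto[OF _ _ \<delta> p abs_unseen_full_prob_le \<alpha>])
    fix m
    show "\<bar>measure_pmf.prob (qht_experiment N k S \<Gamma> m)
      ({(es, T, e, out). out = UNSEEN \<and> full_table N k T} \<inter> {(es, T, e, out). e \<in> set es}) - unseen_full_prob m\<bar>
      \<le> (1 - 1 / real (card \<Gamma>)) ^ m"
      unfolding prob_experiment_unseen[symmetric] prob_experiment_not_duplicate[symmetric] compl[symmetric]
      by (rule abs_prob_Int_diff_le)
    show "\<bar>measure_pmf.prob (qht_experiment N k S \<Gamma> m)
      ({(es, T, e, out). full_table N k T} \<inter> {(es, T, e, out). e \<in> set es}) - full_table_prob m\<bar>
      \<le> (1 - 1 / real (card \<Gamma>)) ^ m"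
      unfolding prob_experiment_full[symmetric] prob_experiment_not_duplicate[symmetric] compl[symmetric]
      by (rule abs_prob_Int_diff_le)
  qed
  finally show ?thesis .
qed

theorem convergent_FNR: "convergent (FNR N k S \<Gamma>)"
proof -
  obtain p where p: "full_table_prob \<longlonglongrightarrow> p" "\<And>m. full_table_prob m \<le> p" by (rule full_table_prob_limit) blast
  obtain \<alpha> where \<alpha>: "mean unseen_full_prob \<longlonglongrightarrow> \<alpha>" using convergent_mean_unseen_full_prob by (auto simp: convergent_def)
  show ?thesis
  proof (cases "p > 0")
    case True
    then show ?thesis using FNR_tendsto[OF p(1) _ \<alpha>] by (auto simp: convergent_def)
  next
    \<comment> \<open>Here a full table has probability 0 at every time, so each \<open>FN\<close>
      is a quotient with denominator 0, which is 0 by convention.\<close>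
    case False
    have "FN N k S \<Gamma> m = 0" for m
    proof -
      have "measure_pmf.prob (qht_experiment N k S \<Gamma> m)
          ({(es, T, e, out). full_table N k T} \<inter> {(es, T, e, out). e \<in> set es}) \<le> full_table_prob m"
        unfolding prob_experiment_full[symmetric] by (rule measure_pmf.finite_measure_mono) auto
      then have "measure_pmf.prob (qht_experiment N k S \<Gamma> m)
          ({(es, T, e, out). full_table N k T} \<inter> {(es, T, e, out). e \<in> set es}) = 0"
        using p(2)[of m] False by (intro antisym) (auto intro: order_trans)
      then show ?thesis by (simp only: FN_eq div_by_0)
    qed
    then show ?thesis by (simp add: FNR_def[abs_def] convergent_const)
  qed
qed

lemma limit_rate_bounds: "0 \<le> 1 - real k / real S" "1 - real k / real S \<le> 1"
  using k kS by auto

text \<open>For balanced hash functions \<open>unseen_prob_close\<close> applies; for the others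
  both terms lie between 0 and 1, so they contribute at most their probability.\<close>

lemma unseen_full_prob_close:
  assumes "\<epsilon> \<ge> 0"
  shows "\<bar>unseen_full_prob m - (1 - real k / real S) * full_table_prob m\<bar> \<le>
    real (N * k) * \<epsilon> + measure_pmf.prob hash_pmf (unbalanced \<epsilon>)"
proof -
  let ?q = "1 - real k / real S"
  let ?u = "\<lambda>(h, s). qht_hashed.unseen_prob N k \<Gamma> h s m" and ?f = "\<lambda>(h, s). qht_hashed.full_prob N k \<Gamma> h s m"
  have bounds: "0 \<le> ?u hs" "?u hs \<le> 1" "0 \<le> ?f hs" "?f hs \<le> 1" if "hs \<in> set_pmf hash_pmf" for hs
  proof -
    obtain h s where hs: "hs = (h, s)" by (cases hs)
    interpret qht_hashed N k S \<Gamma> h s using qht_hashed_hash_pmf that hs by simp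
    show "0 \<le> ?u hs" "?u hs \<le> 1" "0 \<le> ?f hs" "?f hs \<le> 1"
      using full_prob_bounds unseen_prob_bounds by (simp_all add: hs)
  qed
  have pt: "\<bar>?u hs - ?q * ?f hs\<bar> \<le> real (N * k) * \<epsilon> + of_bool (hs \<in> unbalanced \<epsilon>)" if hs: "hs \<in> set_pmf hash_pmf" for hs
  proof (cases "hs \<in> unbalanced \<epsilon>")
    case True
    have "0 \<le> ?q * ?f hs" "?q * ?f hs \<le> 1"
      using bounds[OF hs] limit_rate_bounds by (auto intro: mult_le_one)
    then have "\<bar>?u hs - ?q * ?f hs\<bar> \<le> 1" using bounds[OF hs] by linarith
    moreover have "0 \<le> real (N * k) * \<epsilon>" using assms by simp
    ultimately show ?thesis using True by simp
  next
    case False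
    obtain h s where hs': "hs = (h, s)" by (cases hs)
    interpret qht_hashed N k S \<Gamma> h s using qht_hashed_hash_pmf hs hs' by simp
    have "\<bar>unseen_prob m - ?q * full_prob m\<bar> \<le> real (N * k) * \<epsilon>"
      by (rule unseen_prob_close) (use False assms in \<open>auto simp: unbalanced_def hs' not_le intro: less_imp_le\<close>)
    then show ?thesis using False by (simp add: hs')
  qed
  have int: "integrable (measure_pmf hash_pmf) g" for g :: "_ \<Rightarrow> real"
    by (rule integrable_measure_pmf_finite) (rule finite_set_hash_pmf)
  have eq: "unseen_full_prob m - ?q * full_table_prob m = measure_pmf.expectation hash_pmf (\<lambda>hs. ?u hs - ?q * ?f hs)"
    unfolding unseen_full_prob_def full_table_prob_def by (simp add: int)
  have "\<bar>unseen_full_prob m - ?q * full_table_prob m\<bar> \<le>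
      measure_pmf.expectation hash_pmf (\<lambda>hs. \<bar>?u hs - ?q * ?f hs\<bar>)"
    unfolding eq by (rule integral_abs_bound)
  also have "\<dots> \<le> measure_pmf.expectation hash_pmf (\<lambda>hs. real (N * k) * \<epsilon> + of_bool (hs \<in> unbalanced \<epsilon>))"
    by (rule integral_mono_AE[OF int int AE_pmfI[OF pt]])
  also have "\<dots> = real (N * k) * \<epsilon> + measure_pmf.prob hash_pmf (unbalanced \<epsilon>)"
    using Bochner_Integration.integral_add[OF int int, of "\<lambda>_. real (N * k) * \<epsilon>" "\<lambda>hs. of_bool (hs \<in> unbalanced \<epsilon>)"]
    by (simp add: expectation_of_bool del: of_nat_mult)
  finally show ?thesis .
qed

lemma full_table_prob_ge:
  assumes "0 < \<epsilon>" "\<epsilon> \<le> 1 / real (N * S)"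
  shows "full_table_prob m \<ge> 1 - measure_pmf.prob hash_pmf (unbalanced \<epsilon>) -
    real (N * k) * (1 - 1 / (real (card \<Gamma>) * real (N * k))) ^ m"
proof -
  define t where "t = real (N * k) * (1 - 1 / (real (card \<Gamma>) * real (N * k))) ^ m"
  let ?f = "\<lambda>(h, s). qht_hashed.full_prob N k \<Gamma> h s m"
  have "card \<Gamma> * (N * k) \<ge> 1" using N k \<Gamma> by (simp add: Suc_le_eq card_gt_0_iff)
  then have "real (card \<Gamma>) * real (N * k) \<ge> 1" by (metis of_nat_1 of_nat_le_iff of_nat_mult)
  then have t: "t \<ge> 0" unfolding t_def by (intro mult_nonneg_nonneg zero_le_power) auto
  have pt: "1 - t - of_bool (hs \<in> unbalanced \<epsilon>) \<le> ?f hs" if hs: "hs \<in> set_pmf hash_pmf" for hs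
  proof -
    obtain h s where hs': "hs = (h, s)" by (cases hs)
    interpret qht_hashed N k S \<Gamma> h s using qht_hashed_hash_pmf hs hs' by simp
    show ?thesis
    proof (cases "hs \<in> unbalanced \<epsilon>")
      case True
      then show ?thesis using full_prob_bounds[of m] t by (simp add: hs')
    next
      case False
      \<comment> \<open>A pair that is not attained has frequency 0 and deviates by
        \<open>1 / (N * S)\<close>, which is at least \<epsilon>; balanced functions exclude
        this.\<close>
      have "\<exists>e\<in>\<Gamma>. h e = r \<and> s e = f" if "r < N" "f < S" for r f
      proof (rule ccontr)
        assume "\<not> ?thesis"
        then have "{e\<in>\<Gamma>. h e = r \<and> s e = f} = {}" by blast
        then have "card {e\<in>\<Gamma>. h e = r \<and> s e = f} = 0" by (simp only: card.empty)
        moreover have "\<bar>real (card {e\<in>\<Gamma>. h e = r \<and> s e = f}) / real (card \<Gamma>) - 1 / real (N * S)\<bar> < \<epsilon>"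
          using False that by (auto simp: unbalanced_def hs' not_le)
        ultimately have "\<bar>1 / real (N * S)\<bar> < \<epsilon>" by (simp del: of_nat_mult)
        then show False using assms(2) by linarith
      qed
      from full_prob_ge[OF this] show ?thesis using False by (simp add: hs' t_def)
    qed
  qed
  have int: "integrable (measure_pmf hash_pmf) g" for g :: "_ \<Rightarrow> real"
    by (rule integrable_measure_pmf_finite) (rule finite_set_hash_pmf)
  have "1 - t - measure_pmf.prob hash_pmf (unbalanced \<epsilon>) =
      measure_pmf.expectation hash_pmf (\<lambda>hs. 1 - t - of_bool (hs \<in> unbalanced \<epsilon>))"
    by (subst Bochner_Integration.integral_diff) (simp_all add: int expectation_of_bool)
  also have "\<dots> \<le> full_table_prob m"
    unfolding full_table_prob_def
    by (rule integral_mono_AE[OF int int AE_pmfI[OF pt]])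
  finally show ?thesis by (simp add: t_def)
qed

text \<open>The limiting rate is \<open>\<alpha> / p\<close>. The error
  \<open>\<alpha> - ?q * p\<close> is inherited from the termwise bound in
  \<open>unseen_full_prob_close\<close>, and dividing by \<open>p\<close> is harmless because
  \<open>p\<close> is at least \<open>1 - \<beta>\<close>.\<close>

theorem FNR_inf_close:
  fixes \<epsilon> :: real
  defines "\<beta> \<equiv> real (N * S) * (2 * exp (- 2 * real (card \<Gamma>) * \<epsilon>\<^sup>2))"
  assumes \<epsilon>: "0 < \<epsilon>" "\<epsilon> \<le> 1 / real (N * S)" and \<beta>: "\<beta> < 1"
  shows "\<bar>FNR_inf N k S \<Gamma> - (1 - real k / real S)\<bar> \<le> (real (N * k) * \<epsilon> + \<beta>) / (1 - \<beta>)"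
proof -
  let ?q = "1 - real k / real S" and ?\<eta> = "real (N * k) * \<epsilon> + \<beta>"
  let ?\<rho> = "1 - 1 / (real (card \<Gamma>) * real (N * k))"
  have pb: "measure_pmf.prob hash_pmf (unbalanced \<epsilon>) \<le> \<beta>"
    unfolding \<beta>_def by (rule prob_unbalanced_le) (use \<epsilon> in simp)
  obtain p where p: "full_table_prob \<longlonglongrightarrow> p" by (rule full_table_prob_limit) blast
  obtain \<alpha> where \<alpha>: "mean unseen_full_prob \<longlonglongrightarrow> \<alpha>" using convergent_mean_unseen_full_prob by (auto simp: convergent_def)
  have "card \<Gamma> * (N * k) \<ge> 1" using N k \<Gamma> by (simp add: Suc_le_eq card_gt_0_iff)
  then have "real (card \<Gamma>) * real (N * k) \<ge> 1" by (metis of_nat_1 of_nat_le_iff of_nat_mult)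
  then have "\<bar>?\<rho>\<bar> < 1" by (simp add: abs_less_iff field_simps del: of_nat_mult)
  then have "(\<lambda>m. 1 - \<beta> - real (N * k) * ?\<rho> ^ m) \<longlonglongrightarrow> 1 - \<beta> - real (N * k) * 0"
    by (intro tendsto_intros LIMSEQ_power_zero) simp
  \<comment> \<open>The lower bound of \<open>full_table_prob_ge\<close> as \<open>m\<close> tends
    to infinity, with the alphabet still fixed.\<close>
  then have p_ge: "1 - \<beta> \<le> p"
    by (intro LIMSEQ_le[OF _ p, of _ "1 - \<beta>"] exI[of _ 0] allI impI)
       (use full_table_prob_ge[OF \<epsilon>] pb in \<open>simp_all del: of_nat_mult, smt (verit)\<close>)
  then have p_pos: "p > 0" using \<beta> by linarith
  have "FNR_inf N k S \<Gamma> = \<alpha> / p"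
    unfolding FNR_inf_def by (rule limI) (rule FNR_tendsto[OF p p_pos \<alpha>])
  moreover have "\<bar>\<alpha> - ?q * p\<bar> \<le> ?\<eta>"
  proof (rule LIMSEQ_le_const2)
    show "(\<lambda>n. \<bar>mean unseen_full_prob n - ?q * mean full_table_prob n\<bar>) \<longlonglongrightarrow> \<bar>\<alpha> - ?q * p\<bar>"
      by (intro tendsto_intros \<alpha> mean_tendsto p)
    have "\<bar>mean (\<lambda>m. unseen_full_prob m - ?q * full_table_prob m) n\<bar> \<le> ?\<eta>" for n
    proof (rule abs_mean_le)
      show "\<bar>unseen_full_prob m - ?q * full_table_prob m\<bar> \<le> ?\<eta>" for m
        using unseen_full_prob_close[of \<epsilon> m] \<epsilon> pb by linarith
      show "0 \<le> ?\<eta>" using \<epsilon> by (simp add: \<beta>_def)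
    qed
    then show "\<exists>M. \<forall>n\<ge>M. \<bar>mean unseen_full_prob n - ?q * mean full_table_prob n\<bar> \<le> ?\<eta>"
      by (simp only: mean_diff mean_cmult) blast
  qed
  moreover have "\<alpha> / p - ?q = (\<alpha> - ?q * p) / p" using p_pos by (simp add: diff_divide_distrib)
  ultimately have "\<bar>FNR_inf N k S \<Gamma> - ?q\<bar> \<le> ?\<eta> / p"
    using p_pos by (simp only: abs_divide) (simp add: divide_right_mono del: of_nat_mult)
  also have "\<dots> \<le> ?\<eta> / (1 - \<beta>)"
    using p_ge \<beta> \<epsilon> by (intro divide_left_mono) (auto simp: \<beta>_def)
  finally show ?thesis .
qed

end

text \<open>\<open>FNR_inf\<close> is defined through \<open>lim\<close>, whose value is informative
  only for a convergent sequence; hence the first conjunct. The alphabets are indexed by their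
  size.\<close>

theorem theorem3:
  fixes N k S :: nat and \<Gamma> :: "nat \<Rightarrow> 'a set"
  assumes "1 \<le> N" and "1 \<le> k" and "k \<le> S"
    and "\<And>U. finite (\<Gamma> U)" and "\<And>U. card (\<Gamma> U) = U"
  shows "(\<forall>U\<ge>1. convergent (\<lambda>n. FNR N k S (\<Gamma> U) n)) \<and>
    (\<lambda>U. FNR_inf N k S (\<Gamma> U)) \<longlonglongrightarrow> 1 - real k / real S"
proof
  have qht: "qht N k S (\<Gamma> U)" if "U \<ge> 1" for U
  proof
    show "\<Gamma> U \<noteq> {}" using assms(5)[of U] that by force
  qed (use assms in auto)
  show "\<forall>U\<ge>1. convergent (\<lambda>n. FNR N k S (\<Gamma> U) n)"
    using qht.convergent_FNR[OF qht] by blast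
  show "(\<lambda>U. FNR_inf N k S (\<Gamma> U)) \<longlonglongrightarrow> 1 - real k / real S"
  proof (rule LIMSEQ_I)
    fix e :: real assume e: "e > 0"
    have pos: "real (N * S) > 0" "real (N * k) > 0" using assms(1-3) by auto
    \<comment> \<open>The first bound ensures that all pairs are attained under balanced hashing;
      the second makes \<open>real (N * k) * \<epsilon>\<close> at most
      \<open>e / 4\<close>.\<close>
    define \<epsilon> where "\<epsilon> = min (1 / real (N * S)) (e / (4 * real (N * k)))"
    define \<beta> where "\<beta> = (\<lambda>U. real (N * S) * (2 * exp (- 2 * real U * \<epsilon>\<^sup>2)))"
    have \<epsilon>: "0 < \<epsilon>" "\<epsilon> \<le> 1 / real (N * S)" using pos e by (auto simp: \<epsilon>_def)
    have "\<epsilon> \<le> e / (4 * real (N * k))" by (simp add: \<epsilon>_def)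
    then have \<epsilon>e: "real (N * k) * \<epsilon> \<le> e / 4" using pos by (simp add: field_simps)
    have "exp (- 2 * real U * \<epsilon>\<^sup>2) = exp (- 2 * \<epsilon>\<^sup>2) ^ U" for U
      by (simp add: exp_of_nat_mult[symmetric] mult_ac)
    then have "\<beta> = (\<lambda>U. real (N * S) * (2 * exp (- 2 * \<epsilon>\<^sup>2) ^ U))" by (simp add: \<beta>_def)
    also have "\<dots> \<longlonglongrightarrow> real (N * S) * (2 * 0)"
      using \<epsilon> by (intro tendsto_intros LIMSEQ_power_zero) simp
    finally have "\<beta> \<longlonglongrightarrow> 0" by simp
    \<comment> \<open>The bound \<open>1 / 2\<close> keeps the denominator
      \<open>1 - \<beta> U\<close> above \<open>1 / 2\<close>; with \<open>e / 8\<close> the total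
      error is at most \<open>2 * (e / 4 + e / 8) = 3 * e / 4\<close>.\<close>
    then have "eventually (\<lambda>U. \<beta> U < min (1 / 2) (e / 8)) sequentially"
      by (rule order_tendstoD) (use e in simp)
    then have "eventually (\<lambda>U. norm (FNR_inf N k S (\<Gamma> U) - (1 - real k / real S)) < e) sequentially"
      using eventually_ge_at_top[of 1]
    proof eventually_elim
      case (elim U)
      then have b: "\<beta> U < 1 / 2" "\<beta> U < e / 8" by auto
      have "\<bar>FNR_inf N k S (\<Gamma> U) - (1 - real k / real S)\<bar> \<le> (real (N * k) * \<epsilon> + \<beta> U) / (1 - \<beta> U)"
        using qht.FNR_inf_close[OF qht[OF elim(2)] \<epsilon>] b(1) by (simp add: assms(5) \<beta>_def)
      also have "\<dots> \<le> (e / 4 + e / 8) / (1 / 2)"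
        using \<epsilon>e b e pos \<epsilon> by (intro frac_le) auto
      also have "\<dots> < e" using e by simp
      finally show ?case by simp
    qed
    then show "\<exists>no. \<forall>U\<ge>no. norm (FNR_inf N k S (\<Gamma> U) - (1 - real k / real S)) < e"
      by (simp add: eventually_sequentially)
  qed
qed

end
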